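(* There exists an absolute constant $C_0$ such that the following holds. Let $f\in H^\infty$ and $1\le p<\infty$. For every $\varepsilon,\beta>0$, for every compact subset $K$ of $\mathbb D$, and for every integer $N\ge N(f,\varepsilon,K)$ (a number depending only on $f,\varepsilon,K$) there exists $h\in\mathcal{SF}_N$ such that $$\|f-h\|_{L^\infty(K)}\le\varepsilon,$$ $$\int_0^1|h(e^{2\pi i s}r)|^p\,ds \le (1+\beta)\int_0^1|\Psi_N(e^{2\pi i s}r)|^p\,ds+\rho(\beta)\,C_0^p\,\|f\|^p_{H^\infty}\log^p\frac e{1-r},\qquad 0<r<1.$$
   Context: $\mathbb D$ is the open unit disk of $\mathbb C$ and $\mathbb T$ is the unit circle. $H^\infty$ is the space of bounded analytic functions in $\mathbb D$ with the supremum norm. For $N\ge1$, $\mathcal{SF}_N=\bigl\{\sum_{0\le j<N}\frac1{z-z_{j}}: z_{j}\in\mathbb T,\ 0\le j<N\bigr\}$ (the points $z_j$ need not be distinct), and $\Psi_N(z)=\sum_{0\le k<N}\frac1{z-e^{2\pi ik/N}}$. For $\beta>0$, $$\rho(\beta)=\frac{1+\beta}{\bigl((1+\beta)^{1/(p-1)}-1\bigr)^{p-1}}\quad\text{if }1<p<\infty,\qquad \rho(\beta)=1\quad\text{if }p=1.$$ *)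

theory Defs
  imports "HOL-Complex_Analysis.Complex_Analysis"
begin

text \<open>The element 0 is inserted so that the norm over the empty set is 0
  (the supremum of the empty set of reals is unspecified). The value is meaningful
  only for functions that are bounded on the given set.\<close>

definition sup_norm :: "complex set \<Rightarrow> (complex \<Rightarrow> complex) \<Rightarrow> real" where
  "sup_norm S g = Sup (insert 0 ((\<lambda>z. norm (g z)) ` S))"

text \<open>Functions on the disk are total functions on the complex plane; only their values
  on the disk are constrained.\<close>

definition H_infinity :: "(complex \<Rightarrow> complex) set" where
  "H_infinity = {f. f holomorphic_on ball 0 1 \<and> bounded (f ` ball 0 1)}"

abbreviation H_infinity_norm :: "(complex \<Rightarrow> complex) \<Rightarrow> real" where
  "H_infinity_norm f \<equiv> sup_norm (ball 0 1) f"

definition SF :: "nat \<Rightarrow> (complex \<Rightarrow> complex) set" where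
  "SF N = {(\<lambda>z. \<Sum>j<N. 1 / (z - w j)) | w. \<forall>j<N. w j \<in> sphere 0 1}"

definition Psi :: "nat \<Rightarrow> complex \<Rightarrow> complex" where
  "Psi N z = (\<Sum>k<N. 1 / (z - exp (2 * of_real pi * \<i> * of_nat k / of_nat N)))"

definition circle_mean :: "real \<Rightarrow> (complex \<Rightarrow> complex) \<Rightarrow> real \<Rightarrow> real" where
  "circle_mean p g r =
     integral {0..1} (\<lambda>s::real. norm (g (exp (2 * of_real pi * \<i> * of_real s) * of_real r)) powr p)"

text \<open>Only the values for \<open>p \<ge> 1\<close> and \<open>\<beta> > 0\<close> are meaningful.\<close>

definition rho :: "real \<Rightarrow> real \<Rightarrow> real" where
  "rho p \<beta> =
     (if p = 1 then 1
      else (1 + \<beta>) / (((1 + \<beta>) powr (1 / (p - 1)) - 1) powr (p - 1)))"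

end

theory Submission
  imports Defs "HOL-Computational_Algebra.Fundamental_Theorem_Algebra"
begin

text \<open>Choose a polynomial \<open>P\<close> without zeros in a closed disk larger than the unit disk whose logarithmic derivative
  is bounded by \<open>3 * H_infinity_norm f\<close> and close to \<open>f\<close> on \<open>K\<close>. The polynomial \<open>Q z = P z - z ^ N * cnj (P (1 / cnj z))\<close>
  has degree \<open>N\<close> and all its zeros on the unit circle, so \<open>h = Q' / Q\<close> is in \<open>SF N\<close>, and on compact subsets
  of the disk \<open>h\<close> tends to \<open>P' / P\<close> as \<open>N\<close> grows. Near the unit circle, \<open>h\<close> is compared pointwise with the rotation of \<open>Psi N\<close>
  that moves a pole to the nearest zero of \<open>Q\<close>: the density of the zeros of \<open>Q\<close> differs from \<open>N\<close> by at most a multiple of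
  \<open>H_infinity_norm f\<close>, and so do the two moduli. Integrating the \<open>N\<close> rotated copies over arcs of
  total length \<open>2 * pi\<close> gives the mean of \<open>Psi N\<close> without loss of a factor. The
  error is bounded even without the logarithm.\<close>

section \<open>Means over circles\<close>

text \<open>The factor \<open>1 + \<beta>\<close> may be arbitrarily close to 1, so the leading term
  must be the mean of \<open>Psi N\<close> itself. Only an additive error \<open>E\<close>
  independent of \<open>N\<close> and \<open>r\<close> is affordable; convexity turns it into
  \<open>rho p \<beta> * E powr p\<close>. Two obstacles shape the comparison. The error may depend
  on \<open>f\<close> only through its norm, whereas the derivative of \<open>P' / P\<close> is
  uncontrolled: it enters only through a second-order Taylor term that a large \<open>N\<close>
  absorbs, so it affects the threshold and not the constant. Moreover, neighbouring zeros of
  \<open>Q\<close> may be more than \<open>2 * pi / N\<close> apart, so a point in a gap may lie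
  outside all arcs of half-width \<open>pi / N\<close>; there \<open>h\<close> is compared with the
  minimum of the modulus of \<open>Psi N\<close>. The zeros lie on the circle because the reflected
  term is smaller than \<open>P\<close> inside the disk and reflection in the circle permutes the
  zeros. A larger zero-free disk is taken because the local analysis uses a logarithm of
  \<open>P\<close> on both sides of the circle.\<close>

lemma powr_add_le:
  fixes a b p \<beta> :: real
  assumes "a \<ge> 0" "b \<ge> 0" "p \<ge> 1" "\<beta> > 0"
  shows "(a + b) powr p \<le> (1 + \<beta>) * a powr p + rho p \<beta> * b powr p"
proof (cases "p = 1")
  case True
  then show ?thesis using assms by (simp add: rho_def algebra_simps)
next
  case False
  with assms have p: "p > 1" by simp
  \<comment> \<open>Convexity of the power is used with weights \<open>1 / c\<close> and
    \<open>1 - 1 / c\<close> at the points \<open>a * c\<close> and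
    \<open>b * (c / (c - 1))\<close>. This \<open>c\<close> makes the coefficient
    \<open>c powr (p - 1)\<close> of \<open>a powr p\<close> equal to \<open>1 + \<beta>\<close>;
    then \<open>rho p \<beta>\<close> is the coefficient left for \<open>b powr p\<close>.\<close>
  define c where "c = (1 + \<beta>) powr (1 / (p - 1))"
  have c1: "c > 1" unfolding c_def using assms p by (intro gr_one_powr) auto
  have cp: "c powr (p - 1) = 1 + \<beta>"
    unfolding c_def using assms p by (simp add: powr_powr)
  have rho: "rho p \<beta> = (c / (c - 1)) powr (p - 1)"
    using c1 False by (simp add: rho_def powr_divide cp c_def[symmetric])
  have rho1: "rho p \<beta> \<ge> 1"
    unfolding rho using c1 p by (intro ge_one_powr_ge_zero) (auto simp: field_simps)
  consider "a = 0" | "b = 0" | "a > 0" "b > 0" using assms by linarith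
  then show ?thesis
  proof cases
    case 1
    then show ?thesis using rho1 assms p mult_right_mono[of 1 "rho p \<beta>" "b powr p"] by simp
  next
    case 2
    then show ?thesis using assms p mult_right_mono[of 1 "1 + \<beta>" "a powr p"] by simp
  next
    case 3
    define t where "t = 1 / c"
    have t: "0 < t" "t < 1" using c1 by (auto simp: t_def)
    have eq: "a + b = (1 - t) * (b * (c / (c - 1))) + t * (a * c)"
      using c1 by (simp add: t_def field_simps)
    have pos: "a * c > 0" "b * (c / (c - 1)) > 0" using 3 c1 by auto
    have "(a + b) powr p \<le> (1 - t) * (b * (c / (c - 1))) powr p + t * (a * c) powr p"
      unfolding eq using convex_onD[OF powr_convex[of p], of t "b * (c / (c - 1))" "a * c"] t pos p
      by simp
    also have "t * (a * c) powr p = a powr p * (c powr p / c)"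
      using 3 c1 by (simp add: t_def powr_mult)
    also have "c powr p / c = 1 + \<beta>"
      using c1 cp by (simp add: powr_diff)
    also have "(1 - t) * (b * (c / (c - 1))) powr p = b powr p * ((c / (c - 1)) powr p / (c / (c - 1)))"
    proof -
      have "(b * (c / (c - 1))) powr p = b powr p * (c / (c - 1)) powr p"
        by (simp only: powr_mult)
      moreover have "1 - t = 1 / (c / (c - 1))" using c1 by (simp add: t_def field_simps)
      ultimately show ?thesis by simp
    qed
    also have "(c / (c - 1)) powr p / (c / (c - 1)) = rho p \<beta>"
      unfolding rho using c1 by (simp add: powr_diff)
    finally show ?thesis by (simp add: algebra_simps)
  qed
qed

section \<open>Periodic functions and their restrictions to short arcs\<close>

lemma integral_periodic_shift:
  fixes g :: "real \<Rightarrow> real"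
  assumes cont: "continuous_on UNIV g" and per: "\<And>s. g (s + 1) = g s"
  shows "integral {0..1} (\<lambda>s. g (s - c)) = integral {0..1} g"
proof -
  have int: "g integrable_on {a..b}" for a b
    using cont by (intro integrable_continuous_interval) (auto intro: continuous_on_subset)
  have pern: "g (s + real n) = g s" for s n
  proof (induction n)
    case (Suc n)
    have "g (s + real (Suc n)) = g ((s + real n) + 1)" by (simp add: algebra_simps)
    then show ?case using per Suc by simp
  qed simp
  have peri: "g (of_int k + s) = g s" for s k
    using pern[of s "nat k"] pern[of "s + of_int k" "nat (-k)"]
    by (cases "k \<ge> 0") (auto simp: add.commute)
  have shift: "integral {a + of_int k..b + of_int k} g = integral {a..b} g" for a b k
    using integral_shift_Icc_real[of a b g "of_int k"] by (simp add: o_def peri)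
  define a where "a = - c"
  define n where "n = \<lfloor>a\<rfloor>"
  have n: "of_int n \<le> a" "a \<le> of_int n + 1" unfolding n_def by linarith+
  have "integral {0..1} (\<lambda>s. g (s - c)) = integral {a..a + 1} g"
    using integral_shift_Icc_real[of 0 1 g a] by (simp add: o_def a_def add.commute)
  also have "\<dots> = integral {a..of_int n + 1} g + integral {of_int n + 1..a + 1} g"
    using n int by (subst Henstock_Kurzweil_Integration.integral_combine) auto
  also have "integral {of_int n + 1..a + 1} g = integral {of_int n..a} g"
    using shift[of "of_int n" 1 a] by simp
  also have "integral {a..of_int n + 1} g + integral {of_int n..a} g = integral {of_int n..of_int n + 1} g"
    using n int Henstock_Kurzweil_Integration.integral_combine[of "of_int n" a "of_int n + 1" g] by simp
  also have "\<dots> = integral {0..1} g" using shift[of 0 n 1] by (simp add: add.commute)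
  finally show ?thesis .
qed

text \<open>A cosine describes an arc periodically and continuously; the distance to the integers
  recovered here is what shows that arcs are disjoint.\<close>

lemma near_int_of_cos_gt:
  assumes "cos (2 * pi * y) > cos (pi / real N)" "N \<ge> 1"
  shows "\<exists>a::int. \<bar>y - of_int a\<bar> < 1 / (2 * real N)"
proof
  define d where "d = y - of_int (round y)"
  have d: "\<bar>d\<bar> \<le> 1 / 2" using of_int_round_abs_le[of y] by (simp add: d_def abs_minus_commute)
  have "cos (2 * pi * \<bar>d\<bar>) = cos (2 * pi * d)" by (cases "d \<ge> 0") auto
  also have "\<dots> = cos (2 * pi * y - 2 * pi * of_int (round y))" by (simp add: d_def algebra_simps)
  also have "\<dots> = cos (2 * pi * y)"
    by (simp only: cos_diff cos_int_2pin sin_int_2pin mult_1_right mult_zero_right add_0_right)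
  finally have *: "cos (pi / real N) < cos (2 * pi * \<bar>d\<bar>)" using assms by simp
  have "2 * pi * \<bar>d\<bar> < pi / real N"
  proof (rule ccontr)
    assume "\<not> ?thesis"
    then have "cos (2 * pi * \<bar>d\<bar>) \<le> cos (pi / real N)"
      using d by (intro cos_monotone_0_pi_le) auto
    then show False using * by simp
  qed
  then have "pi * (2 * \<bar>d\<bar>) < pi * (1 / real N)" by simp
  then have "2 * \<bar>d\<bar> < 1 / real N" by (simp only: mult_less_cancel_left_pos pi_gt_zero)
  then show "\<bar>y - of_int (round y)\<bar> < 1 / (2 * real N)" by (simp add: d_def field_simps)
qed

text \<open>The windows around the points \<open>k / N\<close> do not overlap.\<close>

lemma window_integral:
  fixes F :: "real \<Rightarrow> real"
  assumes N: "N \<ge> 1" and cont: "continuous_on UNIV F"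
    and per: "\<And>s k. F (s - real k / real N) = F s"
    and nonneg: "\<And>s. F s \<ge> 0"
    and edge: "\<And>s. cos (2 * pi * s) = cos (pi / real N) \<Longrightarrow> F s = 0"
  defines "q \<equiv> (\<lambda>s. if cos (2 * pi * s) \<ge> cos (pi / real N) then F s else 0)"
  shows "continuous_on UNIV q" "\<And>c. integral {0..1} (\<lambda>s. q (s - c)) = integral {0..1} q"
    "real N * integral {0..1} q \<le> integral {0..1} F"
proof -
  define S where "S = {s::real. cos (2 * pi * s) \<ge> cos (pi / real N)}"
  define T where "T = {s::real. cos (2 * pi * s) \<le> cos (pi / real N)}"
  have ST: "closed S" "closed T" unfolding S_def T_def
    by (intro closed_Collect_le continuous_intros)+
  have "continuous_on (S \<union> T) q"
    unfolding q_def
    by (intro continuous_on_cases ST continuous_intros continuous_on_subset[OF cont])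
       (auto simp: S_def T_def edge)
  also have "S \<union> T = UNIV" by (auto simp: S_def T_def)
  finally show contq: "continuous_on UNIV q" .
  have perF: "F (s + 1) = F s" for s using per[of "s + 1" N] N by simp
  have perq: "q (s + 1) = q s" for s
    using perF[of s] cos_periodic[of "2 * pi * s"] by (simp add: q_def distrib_left)
  show shift: "integral {0..1} (\<lambda>s. q (s - c)) = integral {0..1} q" for c
    by (rule integral_periodic_shift[OF contq perq])
  have qle: "(\<Sum>k<N. q (s - real k / real N)) \<le> F s" for s
  proof (cases "\<exists>k<N. q (s - real k / real N) \<noteq> 0")
    case False
    then show ?thesis using nonneg by simp
  next
    case True
    then obtain k where k: "k < N" "q (s - real k / real N) \<noteq> 0" by blast
    \<comment> \<open>\<open>F\<close> vanishes on the edges, so a nonzero value gives a strict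
      inequality. Two strict half-widths \<open>1 / (2 * N)\<close> add up to less than
      \<open>1 / N\<close>, and an integer over \<open>N\<close> of that size is 0, so two nonzero
      terms would force \<open>N\<close> to divide \<open>k - l\<close>.\<close>
    have near: "\<exists>a::int. \<bar>s - real l / real N - of_int a\<bar> < 1 / (2 * real N)"
      if "q (s - real l / real N) \<noteq> 0" for l
    proof (rule near_int_of_cos_gt[OF _ N])
      show "cos (pi / real N) < cos (2 * pi * (s - real l / real N))"
        using that edge[of "s - real l / real N"]
        by (simp only: q_def split: if_splits) (metis order_le_imp_less_or_eq)+
    qed
    have "q (s - real l / real N) = 0" if l: "l \<in> {..<N} - {k}" for l
    proof (rule ccontr)
      assume "q (s - real l / real N) \<noteq> 0"
      from near[OF this] near[OF k(2)] obtain a b :: int where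
        "\<bar>s - real l / real N - of_int a\<bar> < 1 / (2 * real N)"
        "\<bar>s - real k / real N - of_int b\<bar> < 1 / (2 * real N)"
        by (elim exE)
      then have "\<bar>real k / real N - real l / real N + of_int b - of_int a\<bar> < 1 / real N" by linarith
      also have "real k / real N - real l / real N + of_int b - of_int a
          = of_int (int k - int l + int N * (b - a)) / real N"
        using N by (simp add: field_simps)
      finally have "\<bar>real_of_int (int k - int l + int N * (b - a))\<bar> < 1"
        using N by (simp only: abs_divide) (simp add: divide_less_cancel)
      then have "int k - int l + int N * (b - a) = 0" by linarith
      then have "int N dvd int k - int l"
        by (metis add.commute add_eq_0_iff dvd_minus_iff dvd_triv_left)
      then have "\<not> (0 < \<bar>int k - int l\<bar> \<and> \<bar>int k - int l\<bar> < int N)"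
        using zdvd_imp_le[of "int N" "\<bar>int k - int l\<bar>"] by auto
      then show False using l k by auto
    qed
    then have "(\<Sum>l<N. q (s - real l / real N)) = q (s - real k / real N)"
      using k by (subst sum.remove[of _ k]) auto
    also have "\<dots> \<le> F s" using per nonneg by (auto simp: q_def)
    finally show ?thesis .
  qed
  have intq: "(\<lambda>s. q (s - c)) integrable_on {0..1}" for c
    by (intro integrable_continuous_interval continuous_on_compose2[OF contq] continuous_intros) auto
  have intF: "F integrable_on {0..1}"
    using cont by (intro integrable_continuous_interval) (auto intro: continuous_on_subset)
  have "real N * integral {0..1} q = (\<Sum>k<N. integral {0..1} (\<lambda>s. q (s - real k / real N)))"
    by (simp add: shift)
  also have "\<dots> = integral {0..1} (\<lambda>s. \<Sum>k<N. q (s - real k / real N))"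
    using intq by (subst integral_sum) auto
  also have "\<dots> \<le> integral {0..1} F"
    using intq intF qle by (intro integral_le integrable_sum) auto
  finally show "real N * integral {0..1} q \<le> integral {0..1} F" .
qed

text \<open>\<open>Psi N\<close> is the logarithmic derivative of \<open>z ^ N - 1\<close>. Clearing
  denominators produces geometric sums in the roots of unity \<open>\<omega> k\<close>; after
  summation over \<open>k\<close> only the term without a power of \<open>\<omega> k\<close>
  survives, the one with \<open>z ^ (N - 1)\<close>.\<close>

lemma Psi_eq:
  assumes N: "N \<ge> 1" and z: "z ^ N \<noteq> 1"
  shows "Psi N z = of_nat N * z ^ (N - 1) / (z ^ N - 1)"
proof -
  define \<omega> where "\<omega> k = exp (2 * of_real pi * \<i> * of_nat k / of_nat N)" for k :: nat
  have w: "\<omega> k = \<omega> 1 ^ k" for k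
    by (simp add: \<omega>_def exp_of_nat_mult[symmetric] algebra_simps)
  have wN: "\<omega> k ^ N = 1" for k
    using N complex_root_unity[of N k] by (simp add: \<omega>_def)
  have w1: "\<omega> 1 ^ i \<noteq> 1" if "0 < i" "i < N" for i
  proof
    assume "\<omega> 1 ^ i = 1"
    then have "\<omega> i = \<omega> 0" by (simp add: w[of i]) (simp add: \<omega>_def)
    then have "\<i> * complex_of_real (2 * pi * (real i / real N)) \<in> {z. exp z = 1}"
      by (simp add: \<omega>_def algebra_simps)
    then obtain n :: int where n: "2 * pi * (real i / real N) = of_int (2 * n) * pi"
      by (auto simp: exp_eq_1)
    then have "real i = of_int n * real N" using N by (simp add: field_simps)
    then have "int i = n * int N" by (metis of_int_eq_iff of_int_mult of_int_of_nat_eq)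
    then show False using that
      by (metis dvd_triv_right int_dvd_int_iff nat_dvd_not_less)
  qed
  have sum0: "(\<Sum>k<N. \<omega> k ^ i) = (if i = 0 then of_nat N else 0)" if "i < N" for i
  proof (cases "i = 0")
    case False
    have "(\<Sum>k<N. \<omega> k ^ i) = (\<Sum>k<N. (\<omega> 1 ^ i) ^ k)"
      by (subst w) (simp add: power_mult[symmetric] mult.commute)
    also have "\<dots> = ((\<omega> 1 ^ i) ^ N - 1) / (\<omega> 1 ^ i - 1)"
      using w1[of i] False that by (intro geometric_sum) auto
    also have "(\<omega> 1 ^ i) ^ N = (\<omega> 1 ^ N) ^ i" by (simp add: power_mult[symmetric] mult.commute)
    finally show ?thesis using wN[of 1] False by simp
  qed simp
  have zw: "z \<noteq> \<omega> k" for k using wN z by metis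
  have "(z ^ N - 1) * Psi N z = (\<Sum>k<N. (z ^ N - \<omega> k ^ N) / (z - \<omega> k))"
    by (simp add: Psi_def \<omega>_def[symmetric] wN sum_distrib_left)
  also have "\<dots> = (\<Sum>k<N. \<Sum>i<N. \<omega> k ^ (N - Suc i) * z ^ i)"
    using zw by (intro sum.cong refl) (subst power_diff_sumr2, simp)
  also have "\<dots> = (\<Sum>i<N. z ^ i * (\<Sum>k<N. \<omega> k ^ (N - Suc i)))"
    by (subst sum.swap) (simp add: sum_distrib_left mult.commute)
  also have "\<dots> = (\<Sum>i<N. if i = N - 1 then of_nat N * z ^ i else 0)"
    using N by (intro sum.cong refl) (subst sum0, auto)
  also have "\<dots> = of_nat N * z ^ (N - 1)" using N by (subst sum.delta) auto
  finally show ?thesis using z by (simp add: field_simps)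
qed

lemma cmod_Psi:
  assumes "N \<ge> 1" "cmod z < 1"
  shows "cmod (Psi N z) = real N * cmod z ^ (N - 1) / cmod (z ^ N - 1)"
proof -
  have "cmod (z ^ N) < 1" using assms by (simp add: norm_power power_less_one_iff)
  then have "z ^ N \<noteq> 1" by auto
  then show ?thesis using assms by (simp add: Psi_eq norm_mult norm_divide norm_power)
qed

text \<open>The minimum over the circle of radius \<open>r\<close> is attained where
  \<open>z ^ N = - (r ^ N)\<close>, which includes the edges of the arcs of half-width
  \<open>pi / N\<close> around the poles. This makes a cut-off at these edges continuous.\<close>

definition Psi_min :: "nat \<Rightarrow> real \<Rightarrow> real" where
  "Psi_min N r = real N * r ^ (N - 1) / (1 + r ^ N)"

lemma Psi_min_le:
  assumes "N \<ge> 1" "cmod z < 1"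
  shows "Psi_min N (cmod z) \<le> cmod (Psi N z)"
proof -
  have "cmod (z ^ N) < 1" using assms by (simp add: norm_power power_less_one_iff)
  then have "z ^ N \<noteq> 1" by auto
  then have "0 < cmod (z ^ N - 1)" by simp
  moreover have "cmod (z ^ N - 1) \<le> 1 + cmod z ^ N"
    using norm_triangle_ineq4[of "z ^ N" 1] by (simp add: norm_power)
  ultimately show ?thesis
    using assms unfolding cmod_Psi[OF assms] Psi_min_def
    by (intro divide_left_mono mult_pos_pos) (auto intro: add_pos_nonneg)
qed

text \<open>The hypothesis bounds \<open>h\<close> near each pole by a rotated copy of \<open>Psi N\<close>, cut off to its minimum
  outside the arc of length \<open>2 * pi / N\<close> around the pole. Since \<open>N\<close> such arcs have total length
  \<open>2 * pi\<close>, the cut-off copies integrate to at most the mean of \<open>Psi N\<close>, whatever the overlaps.\<close>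

lemma circle_mean_le:
  fixes w :: "nat \<Rightarrow> complex"
  assumes N: "N \<ge> 1" and p: "p \<ge> 1" and \<beta>: "\<beta> > 0" and r: "0 < r" "r < 1"
    and w: "\<And>j. j < N \<Longrightarrow> cmod (w j) = 1" and E: "E \<ge> 0"
    and h: "continuous_on (ball 0 1) h"
    and bound: "\<And>z. cmod z = r \<Longrightarrow> cmod (h z) \<le> Psi_min N r + E \<or>
       (\<exists>j<N. Re (z / w j) \<ge> r * cos (pi / real N) \<and> cmod (h z) \<le> cmod (Psi N (z / w j)) + E)"
  shows "circle_mean p h r \<le> (1 + \<beta>) * circle_mean p (Psi N) r + rho p \<beta> * E powr p"
proof -
  define c where "c s = exp (2 * of_real pi * \<i> * of_real s) * of_real r" for s :: real
  have normc: "cmod (c s) = r" for s using r by (simp add: c_def norm_mult)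
  have c_cis: "c s = of_real r * cis (2 * pi * s)" for s
    by (simp add: c_def cis_conv_exp algebra_simps)
  have contc: "continuous_on A c" for A unfolding c_def by (intro continuous_intros)
  \<comment> \<open>Splitting off the constant \<open>m\<close> leaves an excess \<open>F\<close>
    that is nonnegative and zero at the edges. Only this excess is summed over the arcs, so the
    minimum is counted once and not once per pole.\<close>
  define m where "m = Psi_min N r powr p"
  define F where "F s = cmod (Psi N (c s)) powr p - m" for s
  have m0: "Psi_min N r \<ge> 0" using r by (simp add: Psi_min_def)
  have cN: "c s ^ N \<noteq> 1" for s
  proof
    assume "c s ^ N = 1"
    then have "cmod (c s) ^ N = 1" by (metis norm_one norm_power)
    moreover have "r ^ N < 1" using r N by (simp add: power_less_one_iff)
    ultimately show False by (simp add: normc)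
  qed
  have modF: "cmod (Psi N (c s)) = real N * r ^ (N - 1) / cmod (c s ^ N - 1)" for s
    using N r by (simp add: cmod_Psi normc)
  have contF: "continuous_on UNIV F"
    unfolding F_def modF using cN p N r
    by (intro continuous_intros contc) auto
  have per: "F (s - real k / real N) = F s" for s k
  proof -
    have cpow: "c x ^ N = exp (of_nat N * (2 * of_real pi * \<i> * of_real x)) * of_real r ^ N" for x
      by (simp only: c_def power_mult_distrib exp_of_nat_mult)
    have "of_nat N * (2 * of_real pi * \<i> * of_real (s - real k / real N))
        = of_nat N * (2 * of_real pi * \<i> * of_real s) + (- (2 * of_real pi * \<i> * of_nat k))"
      using N by (simp add: field_simps)
    then have "c (s - real k / real N) ^ N = c s ^ N * exp (- (2 * of_real pi * \<i> * of_nat k))"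
      unfolding cpow by (simp only: exp_add mult_ac)
    also have "exp (- (2 * of_real pi * \<i> * of_nat k)) = 1"
      using exp_integer_2pi[of "- of_nat k"] by (simp add: algebra_simps)
    finally show ?thesis by (simp add: F_def modF)
  qed
  have nonneg: "F s \<ge> 0" for s
    using Psi_min_le[of N "c s"] N r p m0 by (simp add: F_def m_def normc powr_mono2)
  have edge: "F s = 0" if "cos (2 * pi * s) = cos (pi / real N)" for s
  proof -
    have "cos (2 * pi * s) = cos (pi / real N) \<Longrightarrow> sin (2 * pi * s) = sin (pi / real N) \<or>
        sin (2 * pi * s) = - sin (pi / real N)"
      using sin_cos_squared_add[of "2 * pi * s"] sin_cos_squared_add[of "pi / real N"]
        power2_eq_iff by (metis add_right_cancel)
    then have "cis (2 * pi * s) = cis (pi / real N) \<or> cis (2 * pi * s) = cis (- (pi / real N))"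
      using that by (auto simp: complex_eq_iff)
    moreover have "cis (pi / real N) ^ N = -1" "cis (- (pi / real N)) ^ N = -1"
      using N unfolding Complex.DeMoivre by (simp_all add: complex_eq_iff)
    ultimately have "cis (2 * pi * s) ^ N = -1" by metis
    then have "c s ^ N = - (of_real r ^ N)"
      unfolding c_cis power_mult_distrib by simp
    then have "cmod (c s ^ N - 1) = cmod (of_real (r ^ N + 1))"
      by (metis (no_types, opaque_lifting) minus_diff_commute norm_minus_cancel of_real_1 of_real_add of_real_power diff_minus_eq_add minus_diff_eq add.commute)
    also have "\<dots> = 1 + r ^ N" using r unfolding norm_of_real by simp
    finally show ?thesis by (simp add: F_def modF m_def Psi_min_def)
  qed
  define q where "q s = (if cos (2 * pi * s) \<ge> cos (pi / real N) then F s else 0)" for s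
  note wi = window_integral[OF N contF per nonneg edge, folded q_def]
  have q0: "q s \<ge> 0" for s using nonneg by (simp add: q_def)
  have "\<exists>t. \<forall>j<N. w j = cis (2 * pi * t j)"
  proof (intro exI allI impI)
    fix j assume "j < N"
    then have "cis (Arg (w j)) = w j" using w[of j] cis_Arg[of "w j"] 
      by (metis norm_zero sgn_eq zero_neq_one div_by_1 of_real_1)
    then show "w j = cis (2 * pi * (Arg (w j) / (2 * pi)))" by simp
  qed
  then obtain t where t: "\<And>j. j < N \<Longrightarrow> w j = cis (2 * pi * t j)" by blast
  \<comment> \<open>All copies of \<open>q\<close> are nonnegative, so the sum over every
    \<open>j\<close> dominates the one copy selected by \<open>bound\<close>; the right-hand side no
    longer depends on which pole is near.\<close>
  have pw: "cmod (h (c s)) powr p \<le> (1 + \<beta>) * (m + (\<Sum>j<N. q (s - t j))) + rho p \<beta> * E powr p" for s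
  proof -
    have *: "cmod (h (c s)) powr p \<le> (1 + \<beta>) * (m + (\<Sum>j<N. q (s - t j))) + rho p \<beta> * E powr p"
      if "cmod (h (c s)) \<le> a + E" "a \<ge> 0" "a powr p \<le> m + (\<Sum>j<N. q (s - t j))" for a
    proof -
      have "cmod (h (c s)) powr p \<le> (a + E) powr p" using that p by (intro powr_mono2) auto
      also have "\<dots> \<le> (1 + \<beta>) * a powr p + rho p \<beta> * E powr p"
        using powr_add_le that E p \<beta> by blast
      also have "(1 + \<beta>) * a powr p \<le> (1 + \<beta>) * (m + (\<Sum>j<N. q (s - t j)))"
        using that \<beta> by (intro mult_left_mono) auto
      finally show ?thesis by simp
    qed
    from bound[OF normc[of s]] show ?thesis
    proof
      assume "cmod (h (c s)) \<le> Psi_min N r + E"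
      then show ?thesis using m0 sum_nonneg[of "{..<N}" "\<lambda>j. q (s - t j)"] q0 by (intro *) (auto simp: m_def)
    next
      assume "\<exists>j<N. Re (c s / w j) \<ge> r * cos (pi / real N) \<and>
        cmod (h (c s)) \<le> cmod (Psi N (c s / w j)) + E"
      then obtain j where j: "j < N" "Re (c s / w j) \<ge> r * cos (pi / real N)"
        "cmod (h (c s)) \<le> cmod (Psi N (c s / w j)) + E" by blast
      have eq: "c s / w j = c (s - t j)"
        using t[OF j(1)] by (simp add: c_cis right_diff_distrib flip: cis_divide)
      have "q (s - t j) = F (s - t j)"
        using j(2) r unfolding eq by (simp add: q_def c_cis)
      then have "cmod (Psi N (c s / w j)) powr p = m + q (s - t j)" by (simp add: F_def eq)
      also have "\<dots> \<le> m + (\<Sum>j<N. q (s - t j))"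
        using member_le_sum[of j "{..<N}" "\<lambda>j. q (s - t j)"] j(1) q0 by simp
      finally show ?thesis using j(3) by (intro *[of "cmod (Psi N (c s / w j))"]) auto
    qed
  qed
  have intq: "(\<lambda>s. q (s - a)) integrable_on {0..1}" for a
    by (intro integrable_continuous_interval continuous_on_compose2[OF wi(1)] continuous_intros) auto
  have intF: "F integrable_on {0..1}"
    using contF by (intro integrable_continuous_interval) (auto intro: continuous_on_subset)
  have ints: "(\<lambda>s. \<Sum>j<N. q (s - t j)) integrable_on {0..1}"
    using intq by (intro integrable_sum) auto
  have "continuous_on {0..1} (\<lambda>s. h (c s))"
    using r by (intro continuous_on_compose2[OF h] contc) (auto simp: normc)
  then have "continuous_on {0..1} (\<lambda>s. cmod (h (c s)) powr p)"
    using p by (intro continuous_on_powr') (auto intro!: continuous_intros)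
  then have inth: "(\<lambda>s. cmod (h (c s)) powr p) integrable_on {0..1}"
    by (rule integrable_continuous_interval)
  have "circle_mean p h r = integral {0..1} (\<lambda>s. cmod (h (c s)) powr p)"
    by (simp add: circle_mean_def c_def)
  also have "\<dots> \<le> integral {0..1} (\<lambda>s. (1 + \<beta>) * (m + (\<Sum>j<N. q (s - t j))) + rho p \<beta> * E powr p)"
    using ints by (intro integral_le inth pw integrable_add integrable_on_mult_right) auto
  also have "\<dots> = (1 + \<beta>) * (m + integral {0..1} (\<lambda>s. \<Sum>j<N. q (s - t j))) + rho p \<beta> * E powr p"
    using has_integral_add[OF has_integral_mult_right[OF has_integral_add[OF has_integral_const_real[of m 0 1]
        integrable_integral[OF ints]], of "1 + \<beta>"] has_integral_const_real[of "rho p \<beta> * E powr p" 0 1]]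
    by (simp add: integral_unique)
  \<comment> \<open>An integral over a period does not see the shifts \<open>t j\<close>, so
    arbitrary poles give the same value as equally spaced ones, whose arcs do not overlap.\<close>
  also have "integral {0..1} (\<lambda>s. \<Sum>j<N. q (s - t j)) = real N * integral {0..1} q"
    using intq by (subst integral_sum) (auto simp: wi(2))
  also have "m + \<dots> \<le> m + integral {0..1} F" using wi(3) by simp
  also have "\<dots> = integral {0..1} (\<lambda>s. m + F s)"
    using intF by (subst integral_add) auto
  also have "\<dots> = circle_mean p (Psi N) r"
    by (simp add: F_def circle_mean_def c_def)
  finally show ?thesis using \<beta> by simp
qed

section \<open>Perturbation of equally spaced zeros\<close>

lemma exp_eq_1_iff_of_Im_less:
  fixes y :: complex
  assumes "\<bar>Im y\<bar> < 2 * pi"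
  shows "exp y = 1 \<longleftrightarrow> y = 0"
proof
  assume "exp y = 1"
  then obtain n :: int where n: "Re y = 0" "Im y = of_int (2 * n) * pi" by (auto simp: exp_eq_1)
  have "\<bar>of_int n :: real\<bar> * (2 * pi) < 1 * (2 * pi)" using assms n by (simp add: abs_mult)
  then have "\<bar>of_int n :: real\<bar> < 1" by (simp only: mult_less_cancel_right_pos pi_gt_zero zero_less_mult_iff zero_less_numeral simp_thms)
  then have "n = 0" by linarith
  then show "y = 0" using n by (simp add: complex_eq_iff)
qed simp

text \<open>The singularity of \<open>y / (exp y - 1)\<close> at 0 is removable.\<close>

lemma lipschitz_bernoulli_quotient:
  "\<exists>C::real. C > 0 \<and> (\<forall>y y'::complex. Re y > 0 \<longrightarrow> Re y' > 0 \<longrightarrow> \<bar>Im y\<bar> \<le> 3 * pi / 2 \<longrightarrow> \<bar>Im y'\<bar> \<le> 3 * pi / 2 \<longrightarrow>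
     cmod (y / (exp y - 1)) \<le> C \<and>
     cmod (y / (exp y - 1) - y' / (exp y' - 1)) \<le> C * cmod (y - y'))"
proof -
  define \<phi> :: "complex \<Rightarrow> complex" where "\<phi> = (\<lambda>y. if y = 0 then 1 else (exp y - 1) / y)"
  define S where "S = {y. \<bar>Im y\<bar> < 2 * pi}"
  define \<kappa> where "\<kappa> = (\<lambda>y. 1 / \<phi> y)"
  have "(\<lambda>z. if z = 0 then deriv exp 0 else (exp z - exp 0) / (z - (0::complex))) holomorphic_on UNIV"
    by (intro pole_lemma_open holomorphic_intros) auto
  moreover have "deriv exp (0::complex) = 1" using DERIV_imp_deriv[OF DERIV_exp, of 0] by simp
  ultimately have "\<phi> holomorphic_on UNIV" by (simp add: \<phi>_def cong: if_cong)
  moreover have "\<phi> y \<noteq> 0" if "y \<in> S" for y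
    using that exp_eq_1_iff_of_Im_less[of y] by (auto simp: \<phi>_def S_def)
  ultimately have hol: "\<kappa> holomorphic_on S"
    unfolding \<kappa>_def by (intro holomorphic_intros) (auto intro: holomorphic_on_subset)
  have "open S" unfolding S_def by (intro open_Collect_less continuous_intros)
  then have hol': "deriv \<kappa> holomorphic_on S" using hol by (rule holomorphic_deriv[rotated])
  have \<kappa>: "\<kappa> y = y / (exp y - 1)" if "y \<noteq> 0" for y using that by (simp add: \<kappa>_def \<phi>_def)
  \<comment> \<open>For \<open>Re y \<le> 1\<close> the bounds come from compactness. The height
    \<open>3 * pi / 2\<close> keeps the rectangle away from the zeros of \<open>exp y - 1\<close> at
    \<open>2 * pi * \<i>\<close> and its conjugate.\<close>
  define Q where "Q = cbox (Complex 0 (- (3 * pi / 2))) (Complex 1 (3 * pi / 2))"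
  have QS: "Q \<subseteq> S"
  proof
    fix y assume "y \<in> Q"
    then have "- (3 * pi / 2) \<le> Im y \<and> Im y \<le> 3 * pi / 2" by (auto simp: Q_def in_cbox_complex_iff)
    then show "y \<in> S" using pi_gt_zero unfolding S_def mem_Collect_eq by linarith
  qed
  have "compact (\<kappa> ` Q)" "compact (deriv \<kappa> ` Q)"
    using hol hol' QS by (auto intro!: compact_continuous_image holomorphic_on_imp_continuous_on
      intro: holomorphic_on_subset simp: Q_def)
  then have "bounded (\<kappa> ` Q)" "bounded (deriv \<kappa> ` Q)" by (auto intro: compact_imp_bounded)
  then obtain c1 c2 where c: "\<And>y. y \<in> Q \<Longrightarrow> cmod (\<kappa> y) \<le> c1" "\<And>y. y \<in> Q \<Longrightarrow> cmod (deriv \<kappa> y) \<le> c2"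
    by (auto simp: bounded_iff)
  \<comment> \<open>The value 30 exceeds the explicit bounds 12 and 26 found below for
    \<open>Re y > 1\<close>.\<close>
  define C where "C = max 30 (max c1 c2)"
  define T where "T = {y. Re y > 0 \<and> \<bar>Im y\<bar> \<le> 3 * pi / 2}"
  have "T = {y. Re y > 0} \<inter> {y. Im y \<le> 3 * pi / 2} \<inter> {y. Im y \<ge> - (3 * pi / 2)}"
    by (auto simp: T_def)
  then have convT: "convex T"
    by (simp only:) (intro convex_Int convex_halfspace_Re_gt convex_halfspace_Im_le convex_halfspace_Im_ge)
  have TS: "T \<subseteq> S"
  proof
    fix y assume "y \<in> T"
    then show "y \<in> S" using pi_gt_zero unfolding S_def T_def mem_Collect_eq by linarith
  qed
  have key: "cmod (\<kappa> y) \<le> C \<and> cmod (deriv \<kappa> y) \<le> C" if y: "y \<in> T" for y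
  proof (cases "Re y \<le> 1")
    case True
    then have "y \<in> Q" using y by (auto simp: T_def Q_def in_cbox_complex_iff)
    then show ?thesis using c[of y] by (auto simp: C_def)
  next
    case False
    \<comment> \<open>Here \<open>exp x \<ge> 2\<close>, so the denominator is at least
      \<open>exp x / 2\<close>, while \<open>cmod y \<le> 6 * exp x\<close>. This gives 12 for the
      function and \<open>2 + 24\<close> for its derivative.\<close>
    define x where "x = Re y"
    have x: "x > 1" using False by (simp add: x_def)
    have ex: "exp x \<ge> 1 + x" by (rule exp_ge_add_one_self)
    have "cmod (exp y - 1) \<ge> exp x - 1"
      using norm_triangle_ineq2[of "exp y" 1] by (simp add: x_def)
    then have den: "cmod (exp y - 1) \<ge> exp x / 2" using ex x by linarith
    have "cmod y \<le> \<bar>Re y\<bar> + \<bar>Im y\<bar>" by (rule cmod_le)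
    also have "\<bar>Im y\<bar> \<le> 6" using y pi_less_4 unfolding T_def mem_Collect_eq by linarith
    finally have ny: "cmod y \<le> x + 6" using x by (simp add: x_def)
    have y5: "cmod y \<le> 6 * exp x" using ny ex x by linarith
    have "cmod (exp y - 1) > 0" using den exp_gt_zero[of x] by linarith
    then have y0: "y \<noteq> 0" "exp y \<noteq> 1" by auto
    have inv: "1 / cmod (exp y - 1) \<le> 2 / exp x"
      using frac_le[of 1 1 "exp x / 2" "cmod (exp y - 1)"] den by simp
    have e1: "2 / exp x \<le> 2" using ex x by (simp add: divide_le_eq)
    have alg: "(1 * E - y * (u - 0)) / (E * E) = 1 / E - y * u / E\<^sup>2" if "E \<noteq> 0" for E u :: complex
      using that by (simp add: field_simps power2_eq_square)
    have d: "(\<kappa> has_field_derivative 1 / (exp y - 1) - y * exp y / (exp y - 1)\<^sup>2) (at y)"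
    proof (rule has_field_derivative_transform_within_open[of "\<lambda>y. y / (exp y - 1)" _ _ "- {0}"])
      have "((\<lambda>y. y / (exp y - 1)) has_field_derivative
          (1 * (exp y - 1) - y * (exp y - 0)) / ((exp y - 1) * (exp y - 1))) (at y)"
        by (intro DERIV_divide DERIV_ident DERIV_diff DERIV_exp DERIV_const) (use y0 in simp)
      then show "((\<lambda>y. y / (exp y - 1)) has_field_derivative 1 / (exp y - 1) - y * exp y / (exp y - 1)\<^sup>2) (at y)"
        using alg[of "exp y - 1" "exp y"] y0 by simp
    qed (use y0 \<kappa> in auto)
    have "cmod (\<kappa> y) = cmod y * (1 / cmod (exp y - 1))" using y0 by (simp add: \<kappa> norm_divide)
    also have "\<dots> \<le> (6 * exp x) * (2 / exp x)" by (intro mult_mono y5 inv) auto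
    finally have b1: "cmod (\<kappa> y) \<le> 12" by simp
    have "cmod (deriv \<kappa> y) \<le> cmod (1 / (exp y - 1)) + cmod (y * exp y / (exp y - 1)\<^sup>2)"
      unfolding DERIV_imp_deriv[OF d] by (rule norm_triangle_ineq4)
    also have "\<dots> = 1 / cmod (exp y - 1) + cmod y * exp x * (1 / cmod (exp y - 1))\<^sup>2"
      by (simp add: norm_divide norm_mult norm_power x_def power_divide)
    also have "\<dots> \<le> 2 / exp x + (6 * exp x) * exp x * (2 / exp x)\<^sup>2"
      by (intro add_mono mult_mono power_mono y5 inv) auto
    also have "\<dots> \<le> 26" using e1 by (simp add: power2_eq_square)
    finally show ?thesis using b1 unfolding C_def by linarith
  qed
  have "cmod (\<kappa> y - \<kappa> y') \<le> C * cmod (y - y')" if "y \<in> T" "y' \<in> T" for y y'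
  proof (rule field_differentiable_bound[OF convT])
    fix z assume z: "z \<in> T"
    show "(\<kappa> has_field_derivative deriv \<kappa> z) (at z within T)"
      using hol z TS \<open>open S\<close> by (meson has_field_derivative_at_within holomorphic_derivI subsetD)
  qed (use key that in auto)
  moreover have "y \<noteq> 0" if "y \<in> T" for y using that by (auto simp: T_def)
  moreover have T_iff: "y \<in> T" if "Re y > 0" "\<bar>Im y\<bar> \<le> 3 * pi / 2" for y
    using that unfolding T_def mem_Collect_eq by blast
  moreover have C0: "C > 0" by (simp add: C_def)
  ultimately show ?thesis
    using key \<kappa> T_iff by (intro exI[of _ C]) (metis C0)
qed

text \<open>The zeros of \<open>exp (n * Y + v Y) - 1\<close> near the imaginary axis are a perturbation of equally spaced ones.
  Both quotients are multiples of \<open>y / (exp y - 1)\<close>, which is Lipschitz; the remaining factors \<open>(n + v1 Y) / y\<close>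
  agree up to the second-order Taylor error of \<open>v\<close>, which is small for large \<open>n\<close>.\<close>

lemma quotient_near_nearby_zero:
  fixes v v1 v2 :: "complex \<Rightarrow> complex" and n A L X C :: real
  assumes C: "\<And>y y'. \<lbrakk>Re y > 0; Re y' > 0; \<bar>Im y\<bar> \<le> 3 * pi / 2; \<bar>Im y'\<bar> \<le> 3 * pi / 2\<rbrakk> \<Longrightarrow>
      cmod (y / (exp y - 1)) \<le> C \<and> cmod (y / (exp y - 1) - y' / (exp y' - 1)) \<le> C * cmod (y - y')"
    and v: "\<And>Y. \<bar>Re Y\<bar> < X \<Longrightarrow> (v has_field_derivative v1 Y) (at Y)"
    and v1: "\<And>Y. \<bar>Re Y\<bar> < X \<Longrightarrow> (v1 has_field_derivative v2 Y) (at Y)"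
    and v1A: "\<And>Y. \<bar>Re Y\<bar> < X \<Longrightarrow> cmod (v1 Y) \<le> A"
    and v2L: "\<And>Y. \<bar>Re Y\<bar> < X \<Longrightarrow> cmod (v2 Y) \<le> L"
    and imag: "\<And>s. Re (v (\<i> * of_real s)) = 0"
    and A: "A > 0" and n: "n \<ge> 10 * A" "L \<le> A * (n - A)"
    and Y: "0 < Re Y" "Re Y < X" "A * Re Y \<le> pi / 8"
  shows "\<exists>Y0. Re Y0 = 0 \<and> exp (of_real n * Y0 + v Y0) = 1 \<and> \<bar>Im (Y - Y0)\<bar> \<le> pi / (n - A) \<and>
    cmod ((of_real n + v1 Y) / (exp (of_real n * Y + v Y) - 1) - of_real n / (exp (of_real n * (Y - Y0)) - 1))
      \<le> 2 * C * A"
proof -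
  define S where "S = {Y. \<bar>Re Y\<bar> < X}"
  have "S = {Y. Re Y < X} \<inter> {Y. Re Y > - X}" by (auto simp: S_def)
  then have convS: "convex S"
    by (simp only:) (intro convex_Int convex_halfspace_Re_gt convex_halfspace_Re_lt)
  have vlip: "cmod (v y - v y') \<le> A * cmod (y - y')" if "y \<in> S" "y' \<in> S" for y y'
    by (rule field_differentiable_bound[OF convS, of v v1])
       (use that v v1A in \<open>auto simp: S_def intro: has_field_derivative_at_within\<close>)
  have nA: "n - A > 0" "n > 0" using A n by auto
  define s where "s = Im Y"
  define d where "d = pi / (n - A)"
  have d0: "d > 0" using nA by (simp add: d_def)
  \<comment> \<open>On the imaginary axis \<open>n * Y + v Y\<close> is purely imaginary, and
    \<open>\<phi>\<close> is its phase; the zeros sought are the points where \<open>\<phi>\<close>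
    is a multiple of \<open>2 * pi\<close>. Moving by \<open>d = pi / (n - A)\<close> changes
    \<open>\<phi>\<close> by at least \<open>pi\<close> in either direction, enough to reach the
    nearest multiple.\<close>
  define \<phi> where "\<phi> \<sigma> = n * \<sigma> + Im (v (\<i> * of_real \<sigma>))" for \<sigma>
  have inS: "\<i> * of_real \<sigma> \<in> S" for \<sigma> using Y by (simp add: S_def)
  have "continuous_on S v"
    using v by (auto simp: S_def intro!: continuous_at_imp_continuous_on DERIV_isCont)
  then have "continuous_on UNIV (\<lambda>\<sigma>. v (\<i> * of_real \<sigma>))"
    by (rule continuous_on_compose2) (use inS in \<open>auto intro!: continuous_intros\<close>)
  then have cont: "continuous_on UNIV \<phi>"
    unfolding \<phi>_def by (intro continuous_intros)
  have Imv: "\<bar>Im (v (\<i> * of_real \<sigma>)) - Im (v (\<i> * of_real \<tau>))\<bar> \<le> A * \<bar>\<sigma> - \<tau>\<bar>" for \<sigma> \<tau>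
  proof -
    have "\<bar>Im (v (\<i> * of_real \<sigma>) - v (\<i> * of_real \<tau>))\<bar> \<le> cmod (v (\<i> * of_real \<sigma>) - v (\<i> * of_real \<tau>))"
      by (rule abs_Im_le_cmod)
    also have "\<dots> \<le> A * cmod (\<i> * of_real \<sigma> - \<i> * of_real \<tau>)" by (rule vlip[OF inS inS])
    also have "cmod (\<i> * of_real \<sigma> - \<i> * of_real \<tau>) = \<bar>\<sigma> - \<tau>\<bar>"
      by (metis mult.left_neutral norm_ii norm_mult norm_of_real of_real_diff right_diff_distrib)
    finally show ?thesis by simp
  qed
  have dn: "(n - A) * d = pi" using nA by (simp add: d_def)
  have hi: "\<phi> (s + d) \<ge> \<phi> s + pi"
    using Imv[of "s + d" s] d0 dn by (simp add: \<phi>_def algebra_simps abs_le_iff)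
  have lo: "\<phi> (s - d) \<le> \<phi> s - pi"
    using Imv[of "s - d" s] d0 dn by (simp add: \<phi>_def algebra_simps abs_le_iff)
  define k where "k = round (\<phi> s / (2 * pi))"
  have "\<bar>of_int k - \<phi> s / (2 * pi)\<bar> \<le> 1 / 2" unfolding k_def by (rule of_int_round_abs_le)
  then have "\<bar>of_int k - \<phi> s / (2 * pi)\<bar> * (2 * pi) \<le> 1 / 2 * (2 * pi)"
    by (intro mult_right_mono) auto
  also have "\<bar>of_int k - \<phi> s / (2 * pi)\<bar> * (2 * pi) = \<bar>(of_int k - \<phi> s / (2 * pi)) * (2 * pi)\<bar>"
    by (simp add: abs_mult)
  also have "(of_int k - \<phi> s / (2 * pi)) * (2 * pi) = 2 * pi * of_int k - \<phi> s" by (simp add: algebra_simps)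
  finally have "\<bar>2 * pi * of_int k - \<phi> s\<bar> \<le> pi" by simp
  then have "\<phi> (s - d) \<le> 2 * pi * of_int k" "2 * pi * of_int k \<le> \<phi> (s + d)"
    using hi lo by linarith+
  then obtain \<sigma> where \<sigma>: "s - d \<le> \<sigma>" "\<sigma> \<le> s + d" "\<phi> \<sigma> = 2 * pi * of_int k"
    using IVT'[of \<phi> "s - d" "2 * pi * of_int k" "s + d"] cont d0
    by (auto intro: continuous_on_subset)
  define Y0 where "Y0 = \<i> * of_real \<sigma>"
  define T where "T = Y - Y0"
  define e where "e = v Y - v Y0"
  have Y0S: "Y0 \<in> S" and YS: "Y \<in> S" using inS Y by (auto simp: Y0_def S_def)
  have ReT: "Re T = Re Y" "\<bar>Im T\<bar> \<le> d" using \<sigma> by (auto simp: T_def Y0_def s_def)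
  have exp1: "exp (of_real n * Y0 + v Y0) = 1"
    unfolding exp_eq_1 using imag[of \<sigma>] \<sigma>(3) by (auto simp: Y0_def \<phi>_def intro!: exI[of _ k])
  have eA: "cmod e \<le> A * cmod T" unfolding e_def T_def by (rule vlip[OF YS Y0S])
  have T0: "T \<noteq> 0" using ReT Y by auto
  define y0 where "y0 = of_real n * T"
  define y1 where "y1 = of_real n * T + e"
  have expy1: "exp (of_real n * Y + v Y) = exp y1"
  proof -
    have "of_real n * Y + v Y = y1 + (of_real n * Y0 + v Y0)"
      by (simp add: y1_def T_def e_def algebra_simps)
    then show ?thesis by (simp only: exp_add[of y1] exp1 mult_1_right)
  qed
  \<comment> \<open>The real part of \<open>v\<close> vanishes at the projection of \<open>Y\<close>
    to the imaginary axis, at distance \<open>Re Y\<close>. Hence \<open>Re y1\<close> is at least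
    \<open>(n - A) * Re Y\<close>.\<close>
  have Rey1: "Re y1 > 0"
  proof -
    have "\<bar>Re (v Y - v (\<i> * of_real s))\<bar> \<le> cmod (v Y - v (\<i> * of_real s))" by (rule abs_Re_le_cmod)
    also have "\<dots> \<le> A * cmod (Y - \<i> * of_real s)" by (rule vlip[OF YS inS])
    also have "Y - \<i> * of_real s = of_real (Re Y)" by (simp add: s_def complex_eq_iff)
    finally have "\<bar>Re (v Y)\<bar> \<le> A * Re Y" using Y imag by simp
    moreover have "Re y1 = n * Re Y + Re (v Y)"
      using imag[of \<sigma>] ReT by (simp add: y1_def e_def Y0_def)
    moreover have "(n - A) * Re Y > 0" using nA Y by simp
    ultimately show ?thesis by (simp add: algebra_simps abs_le_iff)
  qed
  \<comment> \<open>The factor 10 in \<open>n \<ge> 10 * A\<close> and the bound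
    \<open>pi / 8\<close> on \<open>A * Re Y\<close> ensure that
    \<open>10 / 9 + 1 / 8 + 1 / 9 \<le> 3 / 2\<close>, so both arguments stay in the strip where
    \<open>C\<close> applies.\<close>
  have nd: "n * d \<le> 10 * pi / 9" "A * d \<le> pi / 9"
    using nA n A by (simp_all add: d_def field_simps)
  have "\<bar>Im y0\<bar> = n * \<bar>Im T\<bar>" using nA by (simp add: y0_def abs_mult)
  also have "\<dots> \<le> n * d" using ReT nA by (intro mult_left_mono) auto
  finally have Imy0: "\<bar>Im y0\<bar> \<le> 10 * pi / 9" using nd by linarith
  have "cmod e \<le> A * (Re Y + d)"
  proof -
    have "cmod T \<le> Re Y + d" using cmod_le[of T] ReT Y by simp
    then show ?thesis using eA A by (meson mult_left_mono order.trans less_imp_le)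
  qed
  also have "\<dots> \<le> pi / 8 + pi / 9" using nd Y by (simp add: distrib_left)
  finally have "cmod e \<le> pi / 8 + pi / 9" .
  then have "\<bar>Im e\<bar> \<le> pi / 8 + pi / 9" using abs_Im_le_cmod[of e] by linarith
  moreover have "Im y1 = Im y0 + Im e" by (simp add: y1_def y0_def)
  ultimately have Imy1: "\<bar>Im y1\<bar> \<le> 3 * pi / 2" using Imy0 pi_gt_zero by linarith
  have Rey0: "Re y0 > 0" using nA ReT Y by (simp add: y0_def)
  have y0': "y0 \<noteq> 0" "y1 \<noteq> 0" using Rey0 Rey1 by auto
  define \<kappa> where "\<kappa> = (\<lambda>y::complex. y / (exp y - 1))"
  have bnd: "cmod (\<kappa> y1) \<le> C" "cmod (\<kappa> y1 - \<kappa> y0) \<le> C * cmod (y1 - y0)"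
    using C[OF Rey1 Rey0 Imy1] Imy0 pi_gt_zero unfolding \<kappa>_def by auto
  have C0: "C \<ge> 0" using bnd(1) norm_ge_zero order.trans by blast
  have ny1: "cmod y1 \<ge> (n - A) * cmod T"
  proof -
    have "cmod (of_real n * T) - cmod e \<le> cmod y1" unfolding y1_def by (rule norm_diff_ineq)
    then show ?thesis using eA nA by (simp add: norm_mult algebra_simps)
  qed
  define F where "F i = (if i = 0 then v else if i = 1 then v1 else v2)" for i :: nat
  have "cmod (F 0 Y0 - (\<Sum>i\<le>1. F i Y * (Y0 - Y) ^ i / fact i)) \<le> L * cmod (Y0 - Y) ^ Suc 1 / fact 1"
  proof (rule complex_Taylor[OF convS _ _ YS Y0S])
    fix i :: nat and x assume "x \<in> S" "i \<le> 1"
    then show "(F i has_field_derivative F (Suc i) x) (at x within S)"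
      using v[of x] v1[of x] by (cases i) (auto simp: F_def S_def intro: has_field_derivative_at_within)
  qed (use v2L in \<open>simp add: F_def S_def\<close>)
  then have "cmod (v Y0 - (v Y + v1 Y * (Y0 - Y))) \<le> L * cmod (Y0 - Y) ^ 2"
    by (simp add: F_def power2_eq_square)
  also have "v Y0 - (v Y + v1 Y * (Y0 - Y)) = v1 Y * T - e" by (simp add: T_def e_def algebra_simps)
  finally have taylor: "cmod (v1 Y * T - e) \<le> L * cmod T ^ 2" by (simp add: T_def norm_minus_commute)
  \<comment> \<open>The terms of order \<open>n\<close> cancel, since \<open>n / y0 = 1 / T\<close>.
    The numerator that remains is the Taylor error, bounded by \<open>L * cmod T ^ 2\<close>; the
    denominator is at least \<open>(n - A) * cmod T ^ 2\<close>, and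
    \<open>L \<le> A * (n - A)\<close> makes the quotient at most \<open>A\<close>.\<close>
  have "(of_real n + v1 Y) / y1 - of_real n / y0 = (v1 Y * T - e) / (T * y1)"
    using y0' T0 nA by (simp add: y0_def field_simps) (simp add: y1_def algebra_simps)
  then have "cmod ((of_real n + v1 Y) / y1 - of_real n / y0) = cmod (v1 Y * T - e) / (cmod T * cmod y1)"
    by (simp add: norm_divide norm_mult)
  also have "\<dots> \<le> (A * (n - A) * cmod T ^ 2) / (cmod T * ((n - A) * cmod T))"
    using taylor n T0 nA A ny1
    by (intro frac_le mult_left_mono mult_pos_pos) (auto intro: order.trans mult_right_mono)
  also have "\<dots> = A" using T0 nA by (simp add: power2_eq_square)
  finally have diff1: "cmod ((of_real n + v1 Y) / y1 - of_real n / y0) \<le> A" .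
  have "(of_real n + v1 Y) / (exp y1 - 1) - of_real n / (exp y0 - 1)
      = (of_real n + v1 Y) / y1 * \<kappa> y1 - of_real n / y0 * \<kappa> y0"
    using y0' by (simp add: \<kappa>_def)
  also have "\<dots> = ((of_real n + v1 Y) / y1 - of_real n / y0) * \<kappa> y1 + of_real n / y0 * (\<kappa> y1 - \<kappa> y0)"
    by (simp add: algebra_simps)
  also have "cmod \<dots> \<le> A * C + 1 / cmod T * (C * (A * cmod T))"
  proof (rule norm_triangle_mono)
    show "cmod (((of_real n + v1 Y) / y1 - of_real n / y0) * \<kappa> y1) \<le> A * C"
      unfolding norm_mult using diff1 bnd A by (intro mult_mono) auto
    have "of_real n / y0 = 1 / T" using nA T0 by (simp add: y0_def)
    then have eq: "cmod (of_real n / y0) = 1 / cmod T" by (simp add: norm_divide)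
    have "cmod (\<kappa> y1 - \<kappa> y0) \<le> C * (A * cmod T)"
      using bnd(2) eA C0 by (auto simp: y1_def y0_def intro: order.trans mult_left_mono)
    then show "cmod (of_real n / y0 * (\<kappa> y1 - \<kappa> y0)) \<le> 1 / cmod T * (C * (A * cmod T))"
      unfolding norm_mult eq by (rule mult_left_mono) simp
  qed
  also have "\<dots> = 2 * C * A" using T0 by simp
  finally have "cmod ((of_real n + v1 Y) / (exp y1 - 1) - of_real n / (exp y0 - 1)) \<le> 2 * C * A" .
  then show ?thesis
    using exp1 ReT expy1 by (intro exI[of _ Y0]) (auto simp: Y0_def T_def y0_def d_def)
qed

text \<open>At \<open>\<bar>Im T\<bar> = pi / n\<close> the exponential is negative and the modulus
  is exactly \<open>n / (1 + exp (n * Re T))\<close>. Beyond that, the argument overshoots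
  \<open>pi\<close> by an angle \<open>\<theta> \<le> pi * A / (n - A)\<close>, which costs at most
  \<open>n * \<theta> \<le> 4 * A\<close>.\<close>

lemma quotient_far_from_zero:
  fixes T :: complex and n A :: real
  assumes A: "A > 0" and n: "n \<ge> 10 * A" and T: "Re T > 0" "pi / n < \<bar>Im T\<bar>" "\<bar>Im T\<bar> \<le> pi / (n - A)"
  shows "cmod (of_real n / (exp (of_real n * T) - 1)) \<le> n / (1 + exp (n * Re T)) + 4 * A"
proof -
  have nA: "n - A > 0" "n > 0" using A n by auto
  define a where "a = exp (n * Re T)"
  define \<theta> where "\<theta> = n * \<bar>Im T\<bar> - pi"
  have a: "a > 1" using T nA by (simp add: a_def)
  have \<theta>0: "\<theta> > 0" using T(2) nA by (simp add: \<theta>_def field_simps)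
  have "n * \<bar>Im T\<bar> \<le> n * (pi / (n - A))" using T(3) nA by (intro mult_left_mono) auto
  also have "\<dots> = pi + pi * A / (n - A)" using nA by (simp add: field_simps)
  finally have \<theta>1: "\<theta> \<le> pi * A / (n - A)" by (simp add: \<theta>_def)
  have "n * \<theta> \<le> n * (pi * A / (n - A))" using \<theta>1 nA by (intro mult_left_mono) auto
  also have "\<dots> \<le> 4 * A"
  proof -
    have "pi \<le> 16 / 5" using pi_approx by simp
    then have "pi * n \<le> 16 / 5 * n" using nA by (intro mult_right_mono) auto
    also have "\<dots> \<le> 4 * (n - A)" using n A by simp
    finally have "n * pi \<le> 4 * (n - A)" by (simp add: mult.commute)
    then have "A * (n * pi) \<le> A * (4 * (n - A))" using A by (intro mult_left_mono) auto
    then show ?thesis using nA by (simp add: pos_divide_le_eq mult_ac)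
  qed
  finally have n\<theta>: "n * \<theta> \<le> 4 * A" .
  have "10 * A * \<theta> \<le> n * \<theta>" using n \<theta>0 by (intro mult_right_mono) auto
  then have "A * (10 * \<theta>) \<le> A * 4" using n\<theta> by simp
  then have \<theta>2: "\<theta> \<le> 1" using A by (simp only: mult_le_cancel_left_pos)
  have "cos \<theta> = 1 - 2 * sin (\<theta> / 2) ^ 2" using cos_double_sin[of "\<theta> / 2"] by simp
  moreover have "sin (\<theta> / 2) ^ 2 \<le> (\<theta> / 2) ^ 2"
    using abs_sin_x_le_abs_x[of "\<theta> / 2"] by (metis abs_le_square_iff)
  ultimately have "cos \<theta> \<ge> 1 - \<theta> * \<theta> / 2" by (simp add: power2_eq_square)
  moreover have "\<theta> * \<theta> \<le> \<theta> * 1" using \<theta>0 \<theta>2 by (intro mult_left_mono) auto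
  ultimately have cos: "cos \<theta> \<ge> 1 - \<theta>" "cos \<theta> \<ge> 0" using \<theta>0 \<theta>2 by linarith+
  define D where "D = cmod (exp (of_real n * T) - 1)"
  have "cos (n * Im T) = cos (n * \<bar>Im T\<bar>)" by (cases "Im T \<ge> 0") auto
  also have "\<dots> = cos (\<theta> + pi)" by (simp add: \<theta>_def)
  finally have "Re (exp (of_real n * T)) = - a * cos \<theta>" by (simp add: Re_exp a_def)
  then have D: "D \<ge> 1 + a * cos \<theta>"
    using abs_Re_le_cmod[of "exp (of_real n * T) - 1"] by (simp add: D_def)
  moreover have "a * cos \<theta> \<ge> 0" using cos a by simp
  ultimately have D1: "D \<ge> 1" by linarith
  have "a * cos \<theta> \<ge> a * (1 - \<theta>)" using cos a by (intro mult_left_mono) auto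
  then have D2: "D \<ge> (1 + a) - a * \<theta>" using D by (simp add: algebra_simps)
  have "1 / D \<le> 1 / (1 + a) + \<theta>"
  proof -
    have "1 + a \<le> D + \<theta> * (1 + a) * D"
    proof -
      have "a * \<theta> \<le> \<theta> * (1 + a) * D"
        using mult_mono[of "a * \<theta>" "\<theta> * (1 + a)" 1 D] D1 \<theta>0 a by (simp add: algebra_simps)
      then show ?thesis using D2 by linarith
    qed
    then show ?thesis using D1 a by (simp add: field_simps)
  qed
  then have "n * (1 / D) \<le> n * (1 / (1 + a) + \<theta>)" using nA by (intro mult_left_mono) auto
  then show ?thesis using n\<theta> nA by (simp add: norm_divide D_def a_def distrib_left)
qed

section \<open>Self-inversive polynomials\<close>

text \<open>\<open>reflect_poly\<close> reverses the coefficients with respect to the actual degree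
  of \<open>P\<close>; the monomial raises this to a reflection of order \<open>N\<close>. In this
  form the reflected term is visibly a polynomial, also at 0.\<close>

definition self_inversive :: "nat \<Rightarrow> complex poly \<Rightarrow> complex poly" where
  "self_inversive N P = P - monom 1 (N - degree P) * reflect_poly (map_poly cnj P)"

lemma degree_map_poly_cnj [simp]: "degree (map_poly cnj P) = degree P"
  by (rule degree_map_poly) auto

lemma poly_reflect_cnj:
  assumes "z \<noteq> 0"
  shows "poly (reflect_poly (map_poly cnj P)) z = z ^ degree P * cnj (poly P (1 / cnj z))"
  using assms by (simp add: poly_reflect_poly_nz inverse_eq_divide)

lemma poly_self_inversive:
  assumes "degree P \<le> N" "z \<noteq> 0"
  shows "poly (self_inversive N P) z = poly P z - z ^ N * cnj (poly P (1 / cnj z))"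
proof -
  have "z ^ (N - degree P) * z ^ degree P = z ^ N" using assms by (simp flip: power_add)
  then show ?thesis
    using assms by (simp add: self_inversive_def poly_monom poly_reflect_cnj flip: mult.assoc)
qed

text \<open>The quotient of the two polynomials is holomorphic on the closed disk, as
  \<open>P\<close> has no zeros there, and has modulus 1 on the circle; the maximum principle
  applies.\<close>

lemma cmod_reflect_le:
  assumes P: "\<And>z. cmod z \<le> 1 \<Longrightarrow> poly P z \<noteq> 0" and z: "cmod z < 1"
  shows "cmod (poly (reflect_poly (map_poly cnj P)) z) \<le> cmod (poly P z)"
proof -
  define b where "b z = poly (reflect_poly (map_poly cnj P)) z / poly P z" for z
  have hol: "b holomorphic_on cball 0 1"
    unfolding b_def using P by (intro holomorphic_intros) auto
  have "cmod (b z) \<le> 1"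
  proof (rule maximum_modulus_frontier[of b "ball 0 1"])
    show "b holomorphic_on interior (ball 0 1)" using hol by (auto intro: holomorphic_on_subset)
    show "continuous_on (closure (ball 0 1)) b" using hol by (auto intro: holomorphic_on_imp_continuous_on)
    fix w :: complex assume "w \<in> frontier (ball 0 1)"
    then have w: "cmod w = 1" by (simp add: frontier_ball)
    then have "1 / cnj w = w"
      by (metis complex_cnj_cnj complex_div_cnj complex_norm_square div_by_1 mult_1 nonzero_eq_divide_eq norm_zero of_real_1 one_power2 zero_neq_one complex_cnj_zero_iff)
    then have "cmod (poly (reflect_poly (map_poly cnj P)) w) = cmod (poly P w)"
      using w by (subst poly_reflect_cnj) (auto simp: norm_mult norm_power)
    then show "cmod (b w) \<le> 1" using P[of w] w by (simp add: b_def norm_divide)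
  qed (use z in auto)
  then show ?thesis using P[of z] z by (simp add: b_def norm_divide)
qed

text \<open>The reflected term carries the extra factor \<open>z ^ (N - degree P)\<close>. The bound
  serves twice: it excludes zeros inside the disk, and it keeps denominators away from 0 as
  \<open>N\<close> grows.\<close>

lemma cmod_self_inversive_ge:
  assumes P: "\<And>z. cmod z \<le> 1 \<Longrightarrow> poly P z \<noteq> 0" and z: "cmod z < 1"
  shows "cmod (poly (self_inversive N P) z) \<ge> cmod (poly P z) * (1 - cmod z ^ (N - degree P))"
proof -
  define q where "q = z ^ (N - degree P) * poly (reflect_poly (map_poly cnj P)) z"
  have "cmod q \<le> cmod z ^ (N - degree P) * cmod (poly P z)"
    unfolding q_def norm_mult norm_power by (intro mult_left_mono cmod_reflect_le P z) auto
  moreover have "cmod (poly P z - q) \<ge> cmod (poly P z) - cmod q" by (rule norm_triangle_ineq2)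
  ultimately show ?thesis
    by (simp add: self_inversive_def poly_monom q_def algebra_simps)
qed

text \<open>Zeros inside are excluded by the lower bound. A zero \<open>z\<close> outside would
  produce the zero \<open>1 / cnj z\<close> inside, because the polynomial reproduces itself up to a
  factor under this reflection.\<close>

lemma self_inversive_root:
  assumes P: "\<And>z. cmod z \<le> 1 \<Longrightarrow> poly P z \<noteq> 0" and N: "degree P < N"
    and root: "poly (self_inversive N P) z = 0"
  shows "cmod z = 1"
proof -
  have inside: "poly (self_inversive N P) w \<noteq> 0" if w: "cmod w < 1" for w
  proof -
    have "cmod w ^ (N - degree P) < 1" using w N by (simp add: power_less_one_iff)
    then have "cmod (poly P w) * (1 - cmod w ^ (N - degree P)) > 0" using P[of w] w by simp
    then show ?thesis using cmod_self_inversive_ge[OF P w, of N] by auto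
  qed
  moreover have False if z: "cmod z > 1"
  proof -
    define w where "w = 1 / cnj z"
    have z0: "z \<noteq> 0" "w \<noteq> 0" using z by (auto simp: w_def)
    have w1: "cmod w < 1" using z by (simp add: w_def norm_divide divide_less_eq)
    have wz: "1 / cnj w = z" by (simp add: w_def)
    have "poly P z = z ^ N * cnj (poly P w)"
      using root N z0 by (simp add: poly_self_inversive w_def)
    then have "cnj (poly P z) = cnj z ^ N * poly P w" by simp
    moreover have "w ^ N * cnj z ^ N = 1" using z0 by (simp add: w_def power_divide)
    ultimately have "w ^ N * cnj (poly P z) = poly P w" by (simp flip: mult.assoc)
    then have "poly (self_inversive N P) w = 0"
      using N z0 by (subst poly_self_inversive) (auto simp: wz)
    then show False using inside[OF w1] by simp
  qed
  ultimately show ?thesis using root by (meson linorder_neqE)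
qed

text \<open>Reflection moves the conjugate of \<open>poly P 0\<close> to the coefficient of
  \<open>z ^ N\<close>. Full degree is what yields exactly \<open>N\<close> terms in the simple
  fraction.\<close>

lemma degree_self_inversive:
  assumes "poly P 0 \<noteq> 0" "degree P < N"
  shows "degree (self_inversive N P) = N"
proof -
  have c0: "coeff (map_poly cnj P) 0 \<noteq> 0" using assms by (simp add: poly_0_coeff_0 coeff_map_poly)
  then have nz: "reflect_poly (map_poly cnj P) \<noteq> 0" by auto
  have "degree (monom 1 (N - degree P) * reflect_poly (map_poly cnj P)) = N - degree P + degree P"
    using c0 nz by (subst degree_mult_eq) (auto simp: degree_monom_eq)
  also have "\<dots> = N" using assms by simp
  finally show ?thesis unfolding self_inversive_def using assms(2)
    by (metis degree_add_eq_right degree_minus diff_conv_add_uminus)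
qed

section \<open>Simple fractions from polynomials with unimodular zeros\<close>

lemma pderiv_prod_list_linear:
  fixes z :: complex
  assumes "z \<notin> set xs"
  shows "poly (pderiv (\<Prod>x\<leftarrow>xs. [:-x, 1:])) z = poly (\<Prod>x\<leftarrow>xs. [:-x, 1:]) z * (\<Sum>x\<leftarrow>xs. 1 / (z - x))"
  using assms
proof (induction xs)
  case (Cons a xs)
  then have "z - a \<noteq> 0" by auto
  moreover have "pderiv [:- a, 1:] = 1" by (simp add: pderiv_pCons)
  ultimately show ?case using Cons
    by (simp only: list.map prod_list.Cons sum_list.Cons pderiv_mult) (simp add: field_simps)
qed simp

text \<open>The zeros are listed with multiplicity, so a multiple zero becomes a repeated term,
  which \<open>SF\<close> permits.\<close>

lemma simple_fraction_of_unimodular_roots: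
  fixes Q :: "complex poly"
  assumes deg: "degree Q = N" and Q0: "Q \<noteq> 0" and roots: "\<And>z. poly Q z = 0 \<Longrightarrow> cmod z = 1"
  obtains w where "\<And>j. j < N \<Longrightarrow> cmod (w j) = 1"
    "\<And>z. poly Q z = 0 \<Longrightarrow> \<exists>j<N. z = w j"
    "\<And>z. poly Q z \<noteq> 0 \<Longrightarrow> (\<Sum>j<N. 1 / (z - w j)) = poly (pderiv Q) z / poly Q z"
proof -
  obtain A where A: "size A = degree Q" "Q = smult (lead_coeff Q) (\<Prod>x\<in>#A. [:-x, 1:])"
    using alg_closed_imp_factorization[OF Q0] by blast
  obtain xs where xs: "mset xs = A" using ex_mset by blast
  define c where "c = lead_coeff Q"
  have c0: "c \<noteq> 0" using Q0 by (simp add: c_def)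
  have len: "length xs = N" using A xs deg by (metis size_mset)
  have "(\<Prod>x\<in>#A. [:-x, 1:]) = (\<Prod>x\<leftarrow>xs. [:-x, 1:])"
    unfolding xs[symmetric] by (simp flip: prod_mset_prod_list)
  then have Q: "Q = smult c (\<Prod>x\<leftarrow>xs. [:-x, 1:])" using A(2) by (simp add: c_def)
  have root_iff: "poly Q z = 0 \<longleftrightarrow> z \<in> set xs" for z
  proof -
    have "poly (\<Prod>x\<leftarrow>xs. [:-x, 1:]) z = 0 \<longleftrightarrow> z \<in> set xs" by (induction xs) auto
    then show ?thesis unfolding Q using c0 by simp
  qed
  show thesis
  proof
    fix j assume "j < N"
    then show "cmod (xs ! j) = 1" using roots root_iff len by auto
  next
    fix z assume "poly Q z = 0"
    then show "\<exists>j<N. z = xs ! j" using root_iff len by (metis in_set_conv_nth)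
  next
    fix z assume z: "poly Q z \<noteq> 0"
    then have "poly (pderiv Q) z = poly Q z * (\<Sum>x\<leftarrow>xs. 1 / (z - x))"
      using pderiv_prod_list_linear[of z xs] root_iff[of z] by (simp add: Q pderiv_smult)
    moreover have "(\<Sum>x\<leftarrow>xs. 1 / (z - x)) = (\<Sum>j<N. 1 / (z - xs ! j))"
      by (simp add: sum_list_sum_nth len atLeast0LessThan)
    ultimately show "(\<Sum>j<N. 1 / (z - xs ! j)) = poly (pderiv Q) z / poly Q z" using z by simp
  qed
qed

text \<open>In \<open>Q' * P - P' * Q\<close> the products without a power of \<open>z\<close>
  cancel, and what is left contains \<open>z ^ (k - 1)\<close> with \<open>k = N - degree P\<close>.
  The growth factor \<open>k\<close> from differentiating the monomial is beaten by
  \<open>r0 ^ (k - 1)\<close>, while \<open>Q\<close> and \<open>P\<close> are bounded below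
  uniformly in \<open>N\<close>.\<close>

lemma logderiv_self_inversive_inside:
  assumes P: "\<And>z. cmod z \<le> 1 \<Longrightarrow> poly P z \<noteq> 0" and r0: "0 < r0" "r0 < 1" and \<delta>: "\<delta> > 0"
  shows "\<exists>N0. \<forall>N\<ge>N0. \<forall>z. cmod z \<le> r0 \<longrightarrow>
     cmod (poly (pderiv (self_inversive N P)) z / poly (self_inversive N P) z - poly (pderiv P) z / poly P z) \<le> \<delta>"
proof -
  define R where "R = reflect_poly (map_poly cnj P)"
  define d where "d = degree P"
  have bdd: "\<exists>B\<ge>0. \<forall>z. cmod z \<le> 1 \<longrightarrow> cmod (poly q z) \<le> B" for q :: "complex poly"
  proof -
    have "compact (poly q ` cball 0 1)" by (intro compact_continuous_image continuous_intros) auto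
    then have "bounded (poly q ` cball 0 1)" by (rule compact_imp_bounded)
    then obtain B where "\<forall>z\<in>cball 0 1. cmod (poly q z) \<le> B" unfolding bounded_iff by blast
    then have "\<And>z. cmod z \<le> 1 \<Longrightarrow> cmod (poly q z) \<le> B" by auto
    then show ?thesis by (intro exI[of _ "max B 0"]) (auto simp: le_max_iff_disj)
  qed
  obtain B1 where B1: "B1 \<ge> 0" "\<And>z. cmod z \<le> 1 \<Longrightarrow> cmod (poly (P * R) z) \<le> B1" using bdd by blast
  obtain B2 where B2: "B2 \<ge> 0" "\<And>z. cmod z \<le> 1 \<Longrightarrow> cmod (poly (pderiv P * R - P * pderiv R) z) \<le> B2"
    using bdd by blast
  have "\<exists>c>0. \<forall>z. cmod z \<le> 1 \<longrightarrow> c \<le> cmod (poly P z)"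
  proof -
    have "\<exists>x\<in>cball 0 1. \<forall>y\<in>cball 0 1. cmod (poly P x) \<le> cmod (poly P y)"
      by (intro continuous_attains_inf continuous_intros) auto
    then obtain x where "cmod x \<le> 1" "\<And>y. cmod y \<le> 1 \<Longrightarrow> cmod (poly P x) \<le> cmod (poly P y)" by auto
    then show ?thesis using P[of x] by (intro exI[of _ "cmod (poly P x)"]) auto
  qed
  then obtain c where c: "c > 0" "\<And>z. cmod z \<le> 1 \<Longrightarrow> c \<le> cmod (poly P z)" by blast
  define H where "H k = (real k * r0 ^ (k - 1) * B1 + r0 ^ k * B2) / (c * (1 - r0) * c)" for k
  have "(\<lambda>k. real (Suc k) * r0 ^ k) \<longlonglongrightarrow> 0"
  proof -
    have "(\<lambda>k. real k * r0 ^ k + r0 ^ k) \<longlonglongrightarrow> 0 + 0"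
      using r0 by (intro tendsto_add powser_times_n_limit_0 LIMSEQ_power_zero) auto
    then show ?thesis by (simp add: algebra_simps)
  qed
  then have "(\<lambda>k. real k * r0 ^ (k - 1)) \<longlonglongrightarrow> 0"
    by (subst filterlim_sequentially_Suc[symmetric]) simp
  then have "H \<longlonglongrightarrow> (0 * B1 + 0 * B2) / (c * (1 - r0) * c)"
    unfolding H_def using r0 c
    by (intro tendsto_divide tendsto_add tendsto_mult tendsto_const LIMSEQ_power_zero) auto
  then have "eventually (\<lambda>k. H k < \<delta>) sequentially"
    using \<delta> by (intro order_tendstoD(2)) auto
  then obtain k0 where k0: "\<And>k. k \<ge> k0 \<Longrightarrow> H k < \<delta>" by (auto simp: eventually_sequentially)
  \<comment> \<open>The summand 1 guarantees \<open>k \<ge> 1\<close>, hence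
    \<open>cmod z ^ k \<le> r0\<close> in the lower bound for \<open>Q\<close>.\<close>
  show ?thesis
  proof (intro exI[of _ "k0 + d + 1"] allI impI)
    fix N z assume N: "k0 + d + 1 \<le> N" and z: "cmod z \<le> r0"
    define k where "k = N - d"
    have k: "k \<ge> k0" "k \<ge> 1" using N by (auto simp: k_def)
    have z1: "cmod z \<le> 1" "cmod z < 1" using z r0 by auto
    define Q where "Q = self_inversive N P"
    have Q: "Q = P - monom 1 k * R" by (simp add: Q_def self_inversive_def k_def d_def R_def)
    have "cmod z ^ k \<le> cmod z ^ 1" using k z1 by (intro power_decreasing) auto
    then have "cmod z ^ k \<le> r0" using z by simp
    then have "c * (1 - r0) \<le> cmod (poly P z) * (1 - cmod z ^ k)"
      using c z1 r0 by (intro mult_mono) auto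
    also have "\<dots> \<le> cmod (poly Q z)"
      unfolding Q_def k_def d_def by (rule cmod_self_inversive_ge[OF P z1(2)])
    finally have Qc: "cmod (poly Q z) \<ge> c * (1 - r0)" .
    moreover have "c * (1 - r0) > 0" using c r0 by simp
    ultimately have nz: "poly Q z \<noteq> 0" "poly P z \<noteq> 0" using P z1 by auto
    have "poly (pderiv Q) z * poly P z - poly (pderiv P) z * poly Q z
        = z ^ k * poly (pderiv P * R - P * pderiv R) z - of_nat k * z ^ (k - 1) * poly (P * R) z"
      by (simp add: Q pderiv_diff pderiv_mult pderiv_monom poly_monom algebra_simps)
    also have "cmod \<dots> \<le> cmod z ^ k * cmod (poly (pderiv P * R - P * pderiv R) z)
        + real k * cmod z ^ (k - 1) * cmod (poly (P * R) z)"
      by (rule order.trans[OF norm_triangle_ineq4]) (simp add: norm_mult norm_power)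
    also have "\<dots> \<le> r0 ^ k * B2 + real k * r0 ^ (k - 1) * B1"
      using B1 B2 z z1 r0 by (intro add_mono mult_mono power_mono mult_nonneg_nonneg) auto
    finally have num: "cmod (poly (pderiv Q) z * poly P z - poly (pderiv P) z * poly Q z)
        \<le> real k * r0 ^ (k - 1) * B1 + r0 ^ k * B2" by simp
    have "poly (pderiv Q) z / poly Q z - poly (pderiv P) z / poly P z
        = (poly (pderiv Q) z * poly P z - poly (pderiv P) z * poly Q z) / (poly Q z * poly P z)"
      using nz by (simp add: field_simps)
    also have "cmod \<dots> \<le> H k"
      unfolding norm_divide norm_mult H_def using num order.trans[OF norm_ge_zero num] Qc c z1 r0
      by (intro frac_le mult_mono mult_pos_pos) (auto intro: order.trans)
    finally show "cmod (poly (pderiv (self_inversive N P)) z / poly (self_inversive N P) z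
        - poly (pderiv P) z / poly P z) \<le> \<delta>"
      using k0[OF k(1)] by (simp add: Q_def)
  qed
qed

text \<open>On the circle \<open>cmod z = exp (- Re Y)\<close>, put \<open>z = exp (- Y)\<close> and \<open>P = exp \<circ> l\<close>. Then the polynomial
  \<open>self_inversive N P\<close> is \<open>P z * (1 - exp (- (N * Y + v Y)))\<close> with
  \<open>v Y = l (exp (- Y)) - cnj (l (cnj (exp Y)))\<close>, which does not depend on \<open>N\<close>.\<close>

lemma logderiv_self_inversive_annulus:
  fixes P :: "complex poly" and C M R :: real
  assumes C: "\<And>y y'. \<lbrakk>Re y > 0; Re y' > 0; \<bar>Im y\<bar> \<le> 3 * pi / 2; \<bar>Im y'\<bar> \<le> 3 * pi / 2\<rbrakk> \<Longrightarrow>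
      cmod (y / (exp y - 1)) \<le> C \<and> cmod (y / (exp y - 1) - y' / (exp y' - 1)) \<le> C * cmod (y - y')"
    and C0: "C > 0" and M: "M > 0" and R: "R > 1" "R \<le> 2"
    and P: "\<And>z. cmod z \<le> R \<Longrightarrow> poly P z \<noteq> 0"
    and PM: "\<And>z. cmod z \<le> R \<Longrightarrow> cmod (poly (pderiv P) z / poly P z) \<le> 3 * M"
  shows "\<exists>r0 N0. 1 / 2 \<le> r0 \<and> r0 < 1 \<and> (\<forall>N\<ge>N0. \<forall>z. r0 < cmod z \<longrightarrow> cmod z < 1 \<longrightarrow>
    (\<exists>\<omega>. poly (self_inversive N P) \<omega> = 0 \<and>
      (cmod (poly (pderiv (self_inversive N P)) z / poly (self_inversive N P) z)
          \<le> Psi_min N (cmod z) + (108 + 48 * C) * M \<or>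
       Re (z / \<omega>) \<ge> cmod z * cos (pi / real N) \<and>
       cmod (poly (pderiv (self_inversive N P)) z / poly (self_inversive N P) z)
          \<le> cmod (Psi N (z / \<omega>)) + (108 + 48 * C) * M)))"
proof -
  \<comment> \<open>With \<open>cmod z < 2\<close> and the bound \<open>3 * M\<close>, the function
    \<open>u z = z * P' z / P z\<close> is at most \<open>6 * M\<close>; \<open>v1\<close> is made
    of two values of \<open>u\<close>.\<close>
  define A where "A = 12 * M"
  have A: "A > 0" using M by (simp add: A_def)
  define R1 where "R1 = (1 + R) / 2"
  have R1: "1 < R1" "R1 < R" using R by (auto simp: R1_def)
  have "poly P holomorphic_on ball 0 R" by (intro holomorphic_intros)
  moreover have "contractible (ball 0 R :: complex set)" by (intro convex_imp_contractible) auto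
  ultimately obtain l where l: "l holomorphic_on ball 0 R" "\<And>z. z \<in> ball 0 R \<Longrightarrow> poly P z = exp (l z)"
    using contractible_imp_holomorphic_log[of "poly P" "ball 0 R"] P by auto
  define l1 where "l1 z = poly (pderiv P) z / poly P z" for z
  have dl: "(l has_field_derivative l1 z) (at z)" if z: "cmod z < R" for z
  proof -
    have d: "(l has_field_derivative deriv l z) (at z)"
      using l(1) z by (intro holomorphic_derivI[of l "ball 0 R"]) auto
    have "((\<lambda>z. exp (l z)) has_field_derivative exp (l z) * deriv l z) (at z)"
      using d by (rule DERIV_fun_exp)
    then have dP: "(poly P has_field_derivative exp (l z) * deriv l z) (at z)"
      by (rule has_field_derivative_transform_within_open[of _ _ _ "ball 0 R"]) (use z l(2) in auto)
    have "poly (pderiv P) z = poly P z * deriv l z"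
      using DERIV_unique[OF poly_DERIV dP] l(2)[of z] z by simp
    then have "deriv l z = l1 z" using P[of z] z by (simp add: l1_def)
    then show ?thesis using d by simp
  qed
  define u where "u z = z * l1 z" for z
  have holu: "u holomorphic_on ball 0 R"
    unfolding u_def l1_def using P by (intro holomorphic_intros) auto
  define u1 where "u1 = deriv u"
  have du: "(u has_field_derivative u1 z) (at z)" if "cmod z < R" for z
    unfolding u1_def using holu that by (intro holomorphic_derivI[of u "ball 0 R"]) auto
  have uM: "cmod (u z) \<le> 6 * M" if "cmod z < R" for z
  proof -
    have "cmod (l1 z) \<le> 3 * M" unfolding l1_def using that by (intro PM) simp
    then have "cmod z * cmod (l1 z) \<le> 2 * (3 * M)" using that R by (intro mult_mono) auto
    then show ?thesis by (simp add: u_def norm_mult)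
  qed
  have "continuous_on (cball 0 R1) u1"
    unfolding u1_def using holu R1
    by (intro holomorphic_on_imp_continuous_on holomorphic_on_subset[OF holomorphic_deriv[OF holu]]) auto
  then have "compact (u1 ` cball 0 R1)" by (intro compact_continuous_image) auto
  then have "bounded (u1 ` cball 0 R1)" by (rule compact_imp_bounded)
  then obtain B where B: "\<forall>z\<in>cball 0 R1. cmod (u1 z) \<le> B" unfolding bounded_iff by blast
  have B0: "B \<ge> 0" using B[rule_format, of 0] R1 by (metis mem_cball_0 norm_ge_zero norm_zero order.trans less_imp_le zero_less_one)
  define L where "L = 4 * B"
  \<comment> \<open>In the strip \<open>\<bar>Re Y\<bar> < X\<close> both \<open>exp (- Y)\<close>
    and \<open>exp Y\<close> lie in the disk of radius \<open>R1 < R\<close>, so both logarithms in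
    \<open>v\<close> are defined and \<open>u1\<close> is bounded by compactness.\<close>
  define X where "X = ln R1"
  have X: "X > 0" "exp X = R1" using R1 by (auto simp: X_def)
  define v where "v Y = l (exp (- Y)) - cnj (l (cnj (exp Y)))" for Y
  define v1 where "v1 Y = - u (exp (- Y)) - cnj (u (cnj (exp Y)))" for Y
  define v2 where "v2 Y = exp (- Y) * u1 (exp (- Y)) - exp Y * cnj (u1 (cnj (exp Y)))" for Y
  have inb: "cmod (exp (- Y)) < R1" "cmod (exp Y) < R1" if "\<bar>Re Y\<bar> < X" for Y
    using that X by (auto simp flip: X(2))
  have conj: "((\<lambda>Y. cnj (g (cnj (exp Y)))) has_field_derivative exp Y * cnj (g' (cnj (exp Y)))) (at Y)"
    if "(g has_field_derivative g' (cnj (exp Y))) (at (cnj (exp Y)))" for g g' Y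
  proof -
    have "((cnj \<circ> g \<circ> cnj) has_field_derivative cnj (g' (cnj (exp Y)))) (at (exp Y))"
      using that by (rule has_field_derivative_cnj_cnj)
    from DERIV_chain2[OF this[unfolded o_def] DERIV_exp] show ?thesis by (simp add: mult.commute)
  qed
  have neg: "((\<lambda>Y. g (exp (- Y))) has_field_derivative - (exp (- Y) * g' (exp (- Y)))) (at Y)"
    if "(g has_field_derivative g' (exp (- Y))) (at (exp (- Y)))" for g g' :: "complex \<Rightarrow> complex" and Y
  proof -
    have "((\<lambda>Y. exp (- Y)) has_field_derivative exp (- Y) * (- 1)) (at Y)"
      by (intro DERIV_fun_exp DERIV_minus DERIV_ident)
    from DERIV_chain2[OF that this] show ?thesis by (simp add: mult.commute)
  qed
  have dv: "(v has_field_derivative v1 Y) (at Y)" if "\<bar>Re Y\<bar> < X" for Y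
    unfolding v_def
    using DERIV_diff[OF neg[of l l1 Y, OF dl] conj[of l l1 Y, OF dl]] inb[OF that] R1
    by (simp add: v1_def u_def complex_cnj_mult)
  have dv1: "(v1 has_field_derivative v2 Y) (at Y)" if "\<bar>Re Y\<bar> < X" for Y
    unfolding v1_def
    using DERIV_diff[OF DERIV_minus[OF neg[of u u1 Y, OF du]] conj[of u u1 Y, OF du]] inb[OF that] R1
    by (simp add: v2_def)
  have v1A: "cmod (v1 Y) \<le> A" if "\<bar>Re Y\<bar> < X" for Y
  proof -
    have "cmod (v1 Y) \<le> cmod (- u (exp (- Y))) + cmod (cnj (u (cnj (exp Y))))"
      unfolding v1_def by (rule norm_triangle_ineq4)
    also have "\<dots> \<le> 6 * M + 6 * M"
      unfolding norm_minus_cancel complex_mod_cnj using inb[OF that] R1 by (intro add_mono uM) auto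
    finally show ?thesis by (simp add: A_def)
  qed
  have v2L: "cmod (v2 Y) \<le> L" if "\<bar>Re Y\<bar> < X" for Y
  proof -
    have "cmod (v2 Y) \<le> cmod (exp (- Y)) * cmod (u1 (exp (- Y))) + cmod (exp Y) * cmod (u1 (cnj (exp Y)))"
      unfolding v2_def by (rule order.trans[OF norm_triangle_ineq4]) (simp only: norm_mult complex_mod_cnj order.refl)
    also have "\<dots> \<le> 2 * B + 2 * B"
      using inb[OF that] R1 R B by (intro add_mono mult_mono) auto
    finally show ?thesis by (simp add: L_def)
  qed
  have imag: "Re (v (\<i> * of_real s)) = 0" for s
  proof -
    have "cnj (exp (\<i> * of_real s)) = exp (- (\<i> * of_real s))" by (simp add: exp_cnj)
    then show ?thesis by (simp add: v_def)
  qed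
  \<comment> \<open>The three terms give, in order, \<open>cmod z \<ge> 1 / 2\<close>, membership in
    the strip, and the condition \<open>A * Re Y \<le> pi / 8\<close> for locating a nearby
    zero.\<close>
  define x0 where "x0 = min (ln 2) (min X (pi / (8 * A)))"
  have x0: "x0 > 0" "x0 \<le> ln 2" "x0 \<le> X" "x0 \<le> pi / (8 * A)" using X A by (auto simp: x0_def)
  define r0 where "r0 = exp (- x0)"
  have r0: "1 / 2 \<le> r0" "r0 < 1"
  proof -
    have "exp (- ln 2) \<le> exp (- x0)" using x0 by simp
    then show "1 / 2 \<le> r0" by (simp add: r0_def exp_minus)
  qed (use x0 in \<open>simp add: r0_def\<close>)
  \<comment> \<open>\<open>L\<close> depends on \<open>P\<close> and not just on \<open>M\<close>;
    this threshold is where it is absorbed, through \<open>L \<le> A * (n - A)\<close>.\<close>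
  obtain N1 :: nat where N1: "real N1 \<ge> A + L / A" using real_arch_simple by blast
  obtain N2 :: nat where N2: "real N2 \<ge> 10 * A" using real_arch_simple by blast
  show ?thesis
  proof (intro exI[of _ r0] exI[of _ "max (degree P + 1) (max N1 N2)"] conjI allI impI r0)
    fix N z assume N: "max (degree P + 1) (max N1 N2) \<le> N" and z: "r0 < cmod z" "cmod z < 1"
    define n where "n = real N"
    have Nd: "degree P \<le> N" "N \<ge> 1" using N by auto
    have n: "n \<ge> 10 * A" "n > 0" "n - A > 0" using N N2 A by (auto simp: n_def)
    have "L / A \<le> n - A" using N N1 by (simp add: n_def)
    then have n': "L \<le> A * (n - A)" using A by (simp add: field_simps)
    have z0: "z \<noteq> 0" using z r0 by auto
    define Y where "Y = - Ln z"
    have zY: "exp (- Y) = z" using z0 by (simp add: Y_def)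
    define x where "x = Re Y"
    have xz: "exp (- x) = cmod z" using norm_exp_eq_Re[of "- Y"] by (simp add: zY x_def)
    have x: "0 < x" "x < x0"
    proof -
      have "exp (- x) < exp 0" using xz z by simp
      then show "0 < x" by simp
      have "exp (- x0) < exp (- x)" using xz z by (simp add: r0_def)
      then show "x < x0" by simp
    qed
    have YX: "\<bar>Re Y\<bar> < X" using x x0 by (simp add: x_def)
    have "A * x \<le> A * (pi / (8 * A))" using x x0 A by (intro mult_left_mono) auto
    then have Ax: "A * Re Y \<le> pi / 8" using A by (simp add: x_def)
    define Q where "Q = self_inversive N P"
    have Qexp: "poly Q (exp (- y)) = exp (l (exp (- y))) * (1 - exp (- (of_nat N * y + v y)))"
      if "\<bar>Re y\<bar> < X" for y
    proof -
      have "1 / cnj (exp (- y)) = cnj (exp y)" by (simp add: exp_minus inverse_eq_divide exp_cnj)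
      then have "poly Q (exp (- y)) = exp (l (exp (- y))) - exp (- y) ^ N * cnj (exp (l (cnj (exp y))))"
        unfolding Q_def poly_self_inversive[OF Nd(1) exp_not_eq_zero] using inb[OF that] R1 l(2) by simp
      also have "exp (- y) ^ N = exp (of_nat N * (- y))" by (simp only: exp_of_nat_mult)
      also have "cnj (exp (l (cnj (exp y)))) = exp (cnj (l (cnj (exp y))))" by (simp only: exp_cnj)
      also have "exp (of_nat N * (- y)) * exp (cnj (l (cnj (exp y))))
          = exp (l (exp (- y))) * exp (- (of_nat N * y + v y))"
        unfolding exp_add[symmetric] by (simp add: v_def algebra_simps)
      finally show ?thesis by (simp add: algebra_simps)
    qed
    define W where "W = exp (of_nat N * Y + v Y)"
    define D where "D = of_nat N + v1 Y"
    have W': "exp (- (of_nat N * Y + v Y)) = 1 / W"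
      unfolding W_def exp_minus by (simp add: inverse_eq_divide)
    \<comment> \<open>The function \<open>poly Q (exp (- y))\<close> is differentiated in both of
      its forms; equating the derivatives gives \<open>z * h = u z - D / (W - 1)\<close>, the
      quotient to which the perturbation estimate applies.\<close>
    have dQ: "((\<lambda>y. poly Q (exp (- y))) has_field_derivative - (z * poly (pderiv Q) z)) (at Y)"
      using neg[of "poly Q" "poly (pderiv Q)" Y, OF poly_DERIV] by (simp add: zY)
    have dE: "((\<lambda>y. exp (l (exp (- y))) * (1 - exp (- (of_nat N * y + v y)))) has_field_derivative
        exp (l z) * (- u z) * (1 - 1 / W) + exp (l z) * (D / W)) (at Y)"
    proof -
      have 1: "((\<lambda>y. exp (l (exp (- y)))) has_field_derivative exp (l z) * (- u z)) (at Y)"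
        using DERIV_fun_exp[OF neg[of l l1 Y, OF dl]] inb[OF YX] R1 by (simp add: zY u_def)
      have "((\<lambda>y. - (of_nat N * y + v y)) has_field_derivative - (of_nat N * 1 + v1 Y)) (at Y)"
        by (intro DERIV_minus DERIV_add DERIV_cmult DERIV_ident dv YX)
      then have "((\<lambda>y. 1 - exp (- (of_nat N * y + v y))) has_field_derivative
          0 - exp (- (of_nat N * Y + v Y)) * (- (of_nat N * 1 + v1 Y))) (at Y)"
        by (intro DERIV_diff DERIV_const DERIV_fun_exp)
      moreover have "0 - exp (- (of_nat N * Y + v Y)) * (- (of_nat N * 1 + v1 Y)) = D / W"
      proof -
        have "0 - i * (- (a * 1 + b)) = (a + b) * i" for a b i :: complex by (simp add: algebra_simps)
        then show ?thesis unfolding W_def exp_minus D_def divide_inverse .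
      qed
      ultimately have 2: "((\<lambda>y. 1 - exp (- (of_nat N * y + v y))) has_field_derivative D / W) (at Y)"
        by simp
      from DERIV_mult[OF 1 2] show ?thesis unfolding W' zY by (simp add: mult.commute)
    qed
    have "open {y. \<bar>Re y\<bar> < X}" by (intro open_Collect_less continuous_intros)
    from has_field_derivative_transform_within_open[OF dE this]
    have "((\<lambda>y. poly Q (exp (- y))) has_field_derivative
        exp (l z) * (- u z) * (1 - 1 / W) + exp (l z) * (D / W)) (at Y)"
      using YX Qexp by simp
    then have eq1: "- (z * poly (pderiv Q) z) = exp (l z) * (- u z) * (1 - 1 / W) + exp (l z) * (D / W)"
      using dQ DERIV_unique by blast
    have eq2: "poly Q z = exp (l z) * (1 - 1 / W)"
      using Qexp[OF YX] unfolding zY W' .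
    have W0: "W \<noteq> 0" by (simp add: W_def)
    obtain Y0 where Y0: "Re Y0 = 0" "exp (of_real n * Y0 + v Y0) = 1" "\<bar>Im (Y - Y0)\<bar> \<le> pi / (n - A)"
      "cmod ((of_real n + v1 Y) / (exp (of_real n * Y + v Y) - 1) - of_real n / (exp (of_real n * (Y - Y0)) - 1))
        \<le> 2 * C * A"
      using quotient_near_nearby_zero[of C X v v1 v2 A L n Y, OF C dv dv1 v1A v2L imag A n(1) n' _ _ Ax] x x0
      by (auto simp: x_def)
    define T where "T = Y - Y0"
    define h where "h = poly (pderiv Q) z / poly Q z"
    define J where "J = of_real n / (exp (of_real n * T) - 1)"
    have ReT: "Re T = x" using Y0 by (simp add: T_def x_def)
    have zh: "z * h = u z - D / (W - 1)" if "W \<noteq> 1"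
    proof -
      have "1 - 1 / W = (W - 1) / W" using W0 by (simp add: field_simps)
      then have eqs: "poly Q z = exp (l z) * (W - 1) / W" "z * poly (pderiv Q) z = exp (l z) * (u z * (W - 1) - D) / W"
        using eq1 eq2 W0 by (auto simp: field_simps)
      have "z * h = (z * poly (pderiv Q) z) / poly Q z" by (simp add: h_def)
      also have "\<dots> = (u z * (W - 1) - D) / (W - 1)" unfolding eqs using W0 by simp
      also have "\<dots> = u z - D / (W - 1)" using that by (simp add: diff_divide_distrib)
      finally show ?thesis .
    qed
    have J: "cmod z * cmod h \<le> cmod J + (6 * M + 24 * C * M)"
    proof (cases "W = 1")
      \<comment> \<open>\<open>W = 1\<close> means \<open>poly Q z = 0\<close>, and division by zero
        then makes \<open>h\<close> equal to 0.\<close>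
      case True
      then have "h = 0" by (simp add: h_def eq2)
      then show ?thesis using C0 M by simp
    next
      case False
      have "cmod (z * h) \<le> cmod (u z) + cmod (D / (W - 1))" unfolding zh[OF False] by (rule norm_triangle_ineq4)
      also have "cmod (D / (W - 1)) \<le> cmod J + cmod (D / (W - 1) - J)"
        using norm_triangle_ineq[of J "D / (W - 1) - J"] by simp
      also have "cmod (D / (W - 1) - J) \<le> 2 * C * A" using Y0(4) by (simp add: D_def W_def J_def T_def n_def)
      also have "cmod (u z) \<le> 6 * M" using z R by (intro uM) auto
      finally show ?thesis by (simp add: norm_mult A_def)
    qed
    define \<omega> where "\<omega> = exp (- Y0)"
    have \<omega>: "poly Q \<omega> = 0"
      using Qexp[of Y0] Y0(1,2) X unfolding \<omega>_def exp_minus[of "of_nat N * Y0 + v Y0"] by (simp add: n_def)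
    have z\<omega>: "z / \<omega> = exp (- T)" unfolding \<omega>_def zY[symmetric] T_def exp_diff[symmetric] by simp
    \<comment> \<open>The errors \<open>6 * M + 24 * C * M\<close> and \<open>4 * A = 48 * M\<close>
      add up to \<open>(54 + 24 * C) * M\<close>; dividing by \<open>cmod z \<ge> 1 / 2\<close>
      doubles this.\<close>
    have conv: "cmod h \<le> b + (108 + 48 * C) * M" if "cmod J \<le> cmod z * b + 48 * M" for b
    proof -
      have "cmod z * cmod h \<le> cmod z * b + (54 + 24 * C) * M" using J that by (simp add: algebra_simps)
      also have "(54 + 24 * C) * M \<le> cmod z * ((108 + 48 * C) * M)"
        using mult_right_mono[of "1 / 2" "cmod z" "(108 + 48 * C) * M"] z r0 C0 M by (simp add: algebra_simps)
      finally have "cmod z * cmod h \<le> cmod z * (b + (108 + 48 * C) * M)" by (simp add: distrib_left)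
      then show ?thesis by (rule mult_left_le_imp_le) (use z0 in simp)
    qed
    have expN: "exp (n * x) = 1 / cmod z ^ N"
      unfolding xz[symmetric] n_def exp_of_nat_mult by (simp add: exp_minus power_one_over inverse_eq_divide)
    have zN: "cmod z ^ N = cmod z * cmod z ^ (N - 1)" using Nd by (metis Suc_pred' less_eq_Suc_le One_nat_def power_Suc)
    have "cmod h \<le> Psi_min N (cmod z) + (108 + 48 * C) * M \<or>
       Re (z / \<omega>) \<ge> cmod z * cos (pi / real N) \<and> cmod h \<le> cmod (Psi N (z / \<omega>)) + (108 + 48 * C) * M"
    \<comment> \<open>The zero found is only known to be within \<open>pi / (n - A)\<close>,
      slightly more than the half-width \<open>pi / n\<close> of an arc. The excess is the case
      treated with \<open>Psi_min\<close>.\<close>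
    proof (cases "\<bar>Im T\<bar> \<le> pi / n")
      case True
      have "pi / n \<le> pi" using Nd by (simp add: n_def field_simps)
      then have "cos (pi / n) \<le> cos \<bar>Im T\<bar>" using True by (intro cos_monotone_0_pi_le) auto
      also have "cos \<bar>Im T\<bar> = cos (Im T)" by (rule cos_abs_real)
      finally have "cmod z * cos (pi / n) \<le> cmod z * cos (Im T)" by (intro mult_left_mono) auto
      also have "\<dots> = Re (z / \<omega>)" unfolding z\<omega> using xz by (simp add: Re_exp ReT)
      finally have 1: "Re (z / \<omega>) \<ge> cmod z * cos (pi / real N)" by (simp add: n_def)
      have c\<omega>: "cmod (z / \<omega>) = cmod z" unfolding z\<omega> using xz by (simp add: ReT)
      define e where "e = exp (of_nat N * T)"
      have pow: "(z / \<omega>) ^ N = 1 / e"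
        unfolding z\<omega> exp_of_nat_mult[symmetric] e_def by (simp add: exp_minus inverse_eq_divide)
      have e: "cmod e = 1 / cmod z ^ N" using expN by (simp add: e_def ReT n_def)
      have e0: "e \<noteq> 0" by (simp add: e_def)
      have "1 / e - 1 = - (e - 1) / e" using e0 by (simp add: field_simps)
      then have "cmod (1 / e - 1) = cmod (e - 1) * cmod z ^ N"
        by (simp add: norm_divide norm_minus_commute e)
      \<comment> \<open>No error arises here: since \<open>z / \<omega> = exp (- T)\<close>, the
        equally spaced quotient \<open>J\<close> has exactly the modulus of the rotated
        \<open>Psi N\<close> times \<open>cmod z\<close>.\<close>
      then have "cmod z * cmod (Psi N (z / \<omega>)) = n / cmod (e - 1)"
        using Nd z z0 c\<omega> by (subst cmod_Psi) (auto simp: n_def pow zN)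
      also have "\<dots> = cmod J" using n by (simp add: J_def e_def norm_divide n_def)
      finally have "cmod J \<le> cmod z * cmod (Psi N (z / \<omega>)) + 48 * M" using M by simp
      from conv[OF this] 1 show ?thesis by blast
    next
      case False
      have "cmod J \<le> n / (1 + exp (n * Re T)) + 4 * A"
        unfolding J_def using False Y0(3) x ReT by (intro quotient_far_from_zero A n) (simp_all flip: T_def)
      also have "n / (1 + exp (n * Re T)) = cmod z * Psi_min N (cmod z)"
      proof -
        define q where "q = cmod z ^ N"
        have "q > 0" using z0 by (simp add: q_def)
        then have "n / (1 + 1 / q) = n * q / (1 + q)" by (simp add: field_simps)
        also have "\<dots> = cmod z * Psi_min N (cmod z)"
          using zN by (simp add: Psi_min_def q_def n_def)
        finally show ?thesis by (simp add: ReT expN q_def)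
      qed
      finally show ?thesis using conv[of "Psi_min N (cmod z)"] by (simp add: A_def)
    qed
    then show "\<exists>\<omega>. poly (self_inversive N P) \<omega> = 0 \<and>
      (cmod (poly (pderiv (self_inversive N P)) z / poly (self_inversive N P) z)
          \<le> Psi_min N (cmod z) + (108 + 48 * C) * M \<or>
       Re (z / \<omega>) \<ge> cmod z * cos (pi / real N) \<and>
       cmod (poly (pderiv (self_inversive N P)) z / poly (self_inversive N P) z)
          \<le> cmod (Psi N (z / \<omega>)) + (108 + 48 * C) * M)"
      using \<omega> unfolding Q_def h_def by blast
  qed
qed

section \<open>Approximation by logarithmic derivatives of polynomials\<close>

lemma compact_in_smaller_disk:
  fixes K :: "complex set"
  assumes K: "compact K" "K \<subseteq> ball 0 1"
  obtains r where "0 < r" "r < 1" "K \<subseteq> cball 0 r"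
proof (cases "K = {}")
  case False
  have "\<exists>x\<in>K. \<forall>y\<in>K. cmod y \<le> cmod x"
    using K False by (intro continuous_attains_sup continuous_intros) auto
  then obtain x where x: "x \<in> K" "\<And>y. y \<in> K \<Longrightarrow> cmod y \<le> cmod x" by blast
  show thesis
    by (rule that[of "max (cmod x) (1/2)"]) (use x K in \<open>auto simp: le_max_iff_disj\<close>)
qed (auto intro: that[of "1/2"])

text \<open>The dilation \<open>f (\<rho> * z)\<close> is holomorphic on a disk of radius
  \<open>1 / \<rho> > 1\<close> and still bounded by \<open>M\<close>. Its Taylor polynomials
  converge uniformly on a disk of radius between 1 and \<open>1 / \<rho>\<close>; an error below
  \<open>M / 2\<close> gives the factor \<open>3 / 2\<close>.\<close>

lemma dilated_taylor_approx:
  fixes f :: "complex \<Rightarrow> complex"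
  assumes hol: "f holomorphic_on ball 0 1" and M: "\<And>z. z \<in> ball 0 1 \<Longrightarrow> cmod (f z) \<le> M" "M > 0"
    and K: "compact K" "K \<subseteq> ball 0 1" and \<epsilon>: "\<epsilon> > 0"
  obtains R g where "R > 1" "R \<le> 2" "\<And>z. cmod z \<le> R \<Longrightarrow> cmod (poly g z) \<le> 3 / 2 * M"
    "\<And>z. z \<in> K \<Longrightarrow> cmod (poly g z - f z) \<le> \<epsilon>"
proof -
  obtain r1 where r1: "0 < r1" "r1 < 1" "K \<subseteq> cball 0 r1" using compact_in_smaller_disk[OF K] by blast
  have "cball 0 r1 \<subseteq> (ball 0 1 :: complex set)" using r1 by auto
  then have "continuous_on (cball 0 r1) f"
    using hol by (meson holomorphic_on_imp_continuous_on holomorphic_on_subset)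
  then have "uniformly_continuous_on (cball 0 r1) f"
    by (intro compact_uniformly_continuous) auto
  then obtain d where d: "d > 0"
    "\<And>x y. cmod x \<le> r1 \<Longrightarrow> cmod y \<le> r1 \<Longrightarrow> dist x y < d \<Longrightarrow> dist (f x) (f y) < \<epsilon> / 2"
  proof -
    have "\<exists>d>0. \<forall>x\<in>cball 0 r1. \<forall>x'\<in>cball 0 r1. dist x' x < d \<longrightarrow> dist (f x') (f x) < \<epsilon> / 2"
      using spec[OF \<open>uniformly_continuous_on (cball 0 r1) f\<close>[unfolded uniformly_continuous_on_def], of "\<epsilon> / 2"] \<epsilon>
      by simp
    then show thesis by (auto intro: that)
  qed
  \<comment> \<open>The bound \<open>3 / 4\<close> keeps \<open>R\<close> below 2; the other term
    moves points of \<open>K\<close> by less than the modulus of continuity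
    \<open>d\<close>.\<close>
  define \<rho> where "\<rho> = max (3 / 4) (1 - d / 2)"
  have \<rho>: "3 / 4 \<le> \<rho>" "\<rho> < 1" "1 - \<rho> < d" using d(1) by (auto simp: \<rho>_def)
  define F where "F z = f (of_real \<rho> * z)" for z
  define R where "R = (1 + 1 / \<rho>) / 2"
  define R' where "R' = 1 / \<rho>"
  have R: "R > 1" "R \<le> 2" "R < R'" using \<rho> by (auto simp: R_def R'_def field_simps)
  have inb: "of_real \<rho> * z \<in> ball 0 1" if "cmod z < R'" for z :: complex
    using that \<rho> by (simp add: norm_mult R'_def field_simps)
  have holF: "F holomorphic_on ball 0 R'"
    unfolding F_def
    by (rule holomorphic_on_compose_gen[OF _ hol, unfolded o_def]) (use inb in \<open>auto intro!: holomorphic_intros\<close>)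
  define a where "a n = (deriv ^^ n) F 0 / fact n" for n
  have sums: "(\<lambda>n. a n * z ^ n) sums F z" if "cmod z < R'" for z
    using holomorphic_power_series[OF holF, of z] that by (simp add: a_def)
  \<comment> \<open>Convergence at a radius strictly between \<open>R\<close> and \<open>R'\<close>
    puts \<open>R\<close> strictly inside the disk of convergence, as uniform convergence on the
    closed disk requires.\<close>
  define S where "S = (R + R') / 2"
  have S: "R < S" "S < R'" "S > 0" using R by (auto simp: S_def)
  have "summable (\<lambda>n. a n * of_real S ^ n)" using sums[of "of_real S"] S by (auto simp: sums_iff)
  then have "ereal S \<le> conv_radius a"
    using conv_radius_geI[of a "of_real S"] S by simp
  then have "ereal R < conv_radius a" using S(1) less_le_trans[of "ereal R" "ereal S"] by simp
  then have "uniform_limit (cball 0 R) (\<lambda>n x. \<Sum>i<n. a i * (x - 0) ^ i) (\<lambda>x. suminf (\<lambda>i. a i * (x - 0) ^ i)) sequentially"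
    by (rule powser_uniform_limit)
  then have "eventually (\<lambda>n. \<forall>x\<in>cball 0 R. dist (\<Sum>i<n. a i * (x - 0) ^ i) (suminf (\<lambda>i. a i * (x - 0) ^ i)) < min (\<epsilon> / 2) (M / 2)) sequentially"
    by (rule uniform_limitD) (use M \<epsilon> in auto)
  then obtain n where n: "\<forall>x\<in>cball 0 R. dist (\<Sum>i<n. a i * (x - 0) ^ i) (suminf (\<lambda>i. a i * (x - 0) ^ i)) < min (\<epsilon> / 2) (M / 2)"
    by (auto simp: eventually_sequentially)
  define g where "g = (\<Sum>i<n. monom (a i) i)"
  have g: "cmod (poly g z - F z) < min (\<epsilon> / 2) (M / 2)" if "cmod z \<le> R" for z
  proof -
    have "suminf (\<lambda>i. a i * z ^ i) = F z" using sums[of z] that R by (auto simp: sums_iff)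
    then show ?thesis using bspec[OF n, of z] that by (simp add: g_def poly_sum poly_monom dist_norm)
  qed
  show thesis
  proof (rule that[of R g])
    fix z :: complex assume z: "cmod z \<le> R"
    have "cmod (F z) \<le> M" using M(1)[OF inb[of z]] z R by (simp add: F_def)
    moreover have "cmod (poly g z) \<le> cmod (F z) + cmod (poly g z - F z)"
      using norm_triangle_ineq[of "F z" "poly g z - F z"] by simp
    ultimately show "cmod (poly g z) \<le> 3 / 2 * M" using g[OF z] by simp
  next
    fix z assume "z \<in> K"
    then have z: "cmod z \<le> r1" using r1 by auto
    have "cmod (of_real \<rho> * z) \<le> cmod z" using \<rho> mult_right_mono[of \<rho> 1 "cmod z"] by (simp add: norm_mult)
    then have z': "cmod (of_real \<rho> * z) \<le> r1" using z by simp
    have "dist (of_real \<rho> * z) z = cmod ((of_real \<rho> - 1) * z)" by (simp add: dist_norm algebra_simps)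
    also have "\<dots> = \<bar>\<rho> - 1\<bar> * cmod z"
      by (metis norm_mult norm_of_real of_real_1 of_real_diff)
    also have "\<dots> \<le> (1 - \<rho>) * 1" using z r1 \<rho> by (intro mult_mono) auto
    finally have "dist (F z) (f z) < \<epsilon> / 2" unfolding F_def using d(2)[OF z' z] \<rho> by simp
    moreover have "cmod (poly g z - F z) < \<epsilon> / 2" using g[of z] z r1 R by simp
    moreover have "cmod (poly g z - f z) \<le> cmod (poly g z - F z) + cmod (F z - f z)"
      using norm_triangle_ineq[of "poly g z - F z" "F z - f z"] by simp
    ultimately show "cmod (poly g z - f z) \<le> \<epsilon>" by (simp add: dist_norm)
  qed (use R in auto)
qed

lemma poly_antiderivative:
  fixes g :: "'a :: field_char_0 poly"
  shows "\<exists>G. pderiv G = g \<and> poly G 0 = 0"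
proof -
  define G where "G = (\<Sum>i\<le>degree g. monom (coeff g i / of_nat (Suc i)) (Suc i))"
  have "pderiv G = (\<Sum>i\<le>degree g. monom (coeff g i) i)"
    unfolding G_def by (simp add: higher_pderiv_sum[of 1, simplified] pderiv_monom del: of_nat_Suc)
  also have "\<dots> = g" by (rule poly_as_sum_of_monoms)
  finally show ?thesis by (intro exI[of _ G]) (simp add: G_def poly_sum poly_monom)
qed

text \<open>The polynomial is \<open>(1 + G / m) ^ m\<close> with \<open>G\<close> a primitive of a polynomial \<open>g\<close> close to \<open>f\<close>:
  its logarithmic derivative is \<open>g / (1 + G / m)\<close>.\<close>

lemma logderiv_approx:
  fixes f :: "complex \<Rightarrow> complex"
  assumes hol: "f holomorphic_on ball 0 1" and M: "\<And>z. z \<in> ball 0 1 \<Longrightarrow> cmod (f z) \<le> M" "M > 0"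
    and K: "compact K" "K \<subseteq> ball 0 1" and \<epsilon>: "\<epsilon> > 0"
  obtains R P where "R > 1" "R \<le> 2" "poly P 0 = 1"
    "\<And>z. cmod z \<le> R \<Longrightarrow> poly P z \<noteq> 0"
    "\<And>z. cmod z \<le> R \<Longrightarrow> cmod (poly (pderiv P) z / poly P z) \<le> 3 * M"
    "\<And>z. z \<in> K \<Longrightarrow> cmod (poly (pderiv P) z / poly P z - f z) \<le> \<epsilon>"
proof -
  obtain R g where R: "R > 1" "R \<le> 2" and gM: "\<And>z. cmod z \<le> R \<Longrightarrow> cmod (poly g z) \<le> 3 / 2 * M"
    and gf: "\<And>z. z \<in> K \<Longrightarrow> cmod (poly g z - f z) \<le> \<epsilon> / 2"
    using dilated_taylor_approx[OF hol M K, of "\<epsilon> / 2"] \<epsilon> by (metis half_gt_zero)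
  obtain G where G: "pderiv G = g" "poly G 0 = 0" using poly_antiderivative by blast
  have "compact (poly G ` cball 0 R)" by (intro compact_continuous_image continuous_intros) auto
  then have "bounded (poly G ` cball 0 R)" by (rule compact_imp_bounded)
  then obtain B where B: "\<forall>z\<in>cball 0 R. cmod (poly G z) \<le> B" unfolding bounded_iff by blast
  \<comment> \<open>\<open>2 * B < m\<close> keeps \<open>1 + G / m\<close> at modulus at least
    \<open>1 / 2\<close>, so \<open>3 / 2 * M\<close> becomes \<open>3 * M\<close>; the other bound
    makes the resulting error \<open>3 * M * B / m\<close> at most
    \<open>\<epsilon> / 2\<close>.\<close>
  obtain m :: nat where m: "real m > max 0 (max (2 * B) (6 * M * B / \<epsilon>))" using reals_Archimedean2 by blast
  then have m0: "m > 0" "2 * B < real m" "6 * M * B / \<epsilon> < real m" by auto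
  define H where "H = 1 + smult (1 / of_nat m) G"
  have polyH: "poly H z = 1 + poly G z / of_nat m" for z by (simp add: H_def)
  have half: "cmod (poly H z) \<ge> 1 / 2" if "cmod z \<le> R" for z
  proof -
    have "cmod (poly G z / of_nat m) \<le> B / real m" using B that m0 by (simp add: norm_divide divide_right_mono)
    also have "\<dots> \<le> 1 / 2" using m0 by (simp add: field_simps)
    finally show ?thesis
      using norm_diff_ineq[of 1 "poly G z / of_nat m"] by (simp add: polyH)
  qed
  have nz: "poly H z \<noteq> 0" if "cmod z \<le> R" for z using half[OF that] by auto
  have ld: "poly (pderiv (H ^ m)) z / poly (H ^ m) z = poly g z / poly H z" if "cmod z \<le> R" for z
  proof -
    have "pderiv (H ^ m) = smult (of_nat m) (H ^ (m - 1)) * smult (1 / of_nat m) g"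
      using m0 pderiv_power_Suc[of H "m - 1"] by (simp add: H_def pderiv_add pderiv_smult G)
    moreover have "poly (H ^ m) z = poly (H ^ (m - 1)) z * poly H z"
      using m0 by (metis power_minus_mult poly_mult)
    ultimately show ?thesis using nz[OF that] m0 by simp
  qed
  show thesis
  proof (rule that[of R "H ^ m"])
    show "poly (H ^ m) 0 = 1" by (simp add: polyH G)
    fix z :: complex assume z: "cmod z \<le> R"
    show "poly (H ^ m) z \<noteq> 0" using nz[OF z] by simp
    have "cmod (poly g z / poly H z) \<le> (3 / 2 * M) / (1 / 2)"
      unfolding norm_divide using gM[OF z] half[OF z] M by (intro frac_le) auto
    then show "cmod (poly (pderiv (H ^ m)) z / poly (H ^ m) z) \<le> 3 * M" by (simp only: ld[OF z]) simp
  next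
    fix z assume z: "z \<in> K"
    then have zR: "cmod z \<le> R" using K R by fastforce
    have "poly g z / poly H z - poly g z = - (poly g z / poly H z) * (poly G z / of_nat m)"
      using nz[OF zR] m0 by (simp add: polyH field_simps)
    also have "cmod \<dots> \<le> ((3 / 2 * M) / (1 / 2)) * (B / real m)"
      unfolding norm_mult norm_minus_cancel norm_divide norm_of_nat
      using gM[OF zR] half[OF zR] M B zR m0 by (intro mult_mono frac_le divide_right_mono) auto
    also have "\<dots> \<le> \<epsilon> / 2" using m0 \<epsilon> by (simp add: field_simps)
    finally have "cmod (poly g z / poly H z - poly g z) \<le> \<epsilon> / 2" .
    moreover have "cmod (poly g z / poly H z - f z) \<le> cmod (poly g z / poly H z - poly g z) + cmod (poly g z - f z)"
      using norm_triangle_ineq[of "poly g z / poly H z - poly g z" "poly g z - f z"] by simp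
    ultimately show "cmod (poly (pderiv (H ^ m)) z / poly (H ^ m) z - f z) \<le> \<epsilon>"
      using gf[OF z] by (simp only: ld[OF zR])
  qed (use R in auto)
qed

section \<open>Approximation in the disk\<close>

lemma sup_norm_leI:
  assumes "\<And>z. z \<in> S \<Longrightarrow> cmod (g z) \<le> e" "e \<ge> 0"
  shows "sup_norm S g \<le> e"
  unfolding sup_norm_def using assms by (intro cSup_least) auto

lemma cmod_le_H_infinity_norm:
  assumes "f \<in> H_infinity" "z \<in> ball 0 1"
  shows "cmod (f z) \<le> H_infinity_norm f"
proof -
  obtain b where "\<forall>x\<in>f ` ball 0 1. cmod x \<le> b"
    using assms(1) unfolding H_infinity_def bounded_iff by blast
  then have "bdd_above (insert 0 ((\<lambda>z. cmod (f z)) ` ball 0 1))"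
    unfolding bdd_above_insert by (intro bdd_aboveI[of _ b]) auto
  then show ?thesis unfolding sup_norm_def using assms(2) by (intro cSup_upper) auto
qed

lemma continuous_on_simple_fraction:
  assumes "\<And>j. j < N \<Longrightarrow> cmod (w j) = 1"
  shows "continuous_on (ball 0 1) (\<lambda>z. \<Sum>j<N. 1 / (z - w j))"
  using assms by (intro continuous_intros) auto

section \<open>\<open>Psi N\<close> as an approximation of the zero function\<close>

lemma Psi_in_SF: "N \<ge> 1 \<Longrightarrow> Psi N \<in> SF N"
  unfolding SF_def Psi_def[abs_def] mem_Collect_eq
  by (intro exI[of _ "\<lambda>k. exp (2 * of_real pi * \<i> * of_nat k / of_nat N)"]) (simp add: fun_eq_iff)

lemma Psi_uniformly_small:
  assumes r: "0 < r" "r < 1" and \<epsilon>: "\<epsilon> > 0"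
  shows "\<exists>N0. \<forall>N\<ge>N0. N \<ge> 1 \<longrightarrow> (\<forall>z. cmod z \<le> r \<longrightarrow> cmod (Psi N z) \<le> \<epsilon>)"
proof -
  have "(\<lambda>N. real N * r ^ N / (r * (1 - r))) \<longlonglongrightarrow> 0 / (r * (1 - r))"
    using r by (intro tendsto_divide powser_times_n_limit_0 tendsto_const) auto
  then have "eventually (\<lambda>N. real N * r ^ N / (r * (1 - r)) < \<epsilon>) sequentially"
    using \<epsilon> by (intro order_tendstoD(2)) auto
  then obtain N0 where N0: "\<And>N. N \<ge> N0 \<Longrightarrow> real N * r ^ N / (r * (1 - r)) < \<epsilon>"
    by (auto simp: eventually_sequentially)
  show ?thesis
  proof (intro exI[of _ N0] allI impI)
    fix N z assume N: "N0 \<le> N" "1 \<le> N" and z: "cmod z \<le> r"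
    have "cmod z ^ N \<le> cmod z ^ 1" using N z r by (intro power_decreasing) auto
    then have "1 - r \<le> cmod (z ^ N - 1)"
      using norm_triangle_ineq2[of 1 "z ^ N"] z by (simp add: norm_power norm_minus_commute)
    moreover have "cmod z ^ (N - 1) \<le> r ^ (N - 1)" using z by (intro power_mono) auto
    ultimately have "cmod (Psi N z) \<le> real N * r ^ (N - 1) / (1 - r)"
      using N z r by (subst cmod_Psi) (auto intro!: frac_le mult_left_mono)
    also have "r ^ (N - 1) = r ^ N / r" using N r by (simp add: power_diff)
    also have "real N * (r ^ N / r) / (1 - r) = real N * r ^ N / (r * (1 - r))" by simp
    finally show "cmod (Psi N z) \<le> \<epsilon>" using N0[OF N(1)] by simp
  qed
qed

lemma one_le_rho:
  assumes "p \<ge> 1" "\<beta> > 0"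
  shows "1 \<le> rho p \<beta>"
  using powr_add_le[of 0 1 p \<beta>] assms by simp

text \<open>Norm 0 is treated separately because the perturbation estimates take a positive bound
  \<open>M\<close>. Then \<open>f\<close> vanishes on the disk, and \<open>Psi N\<close> itself
  serves as the fraction.\<close>

lemma Psi_approx_zero:
  assumes f: "f \<in> H_infinity" and f0: "H_infinity_norm f = 0"
    and \<epsilon>: "\<epsilon> > 0" and K: "compact K" "K \<subseteq> ball 0 1"
  shows "\<exists>N0. \<forall>N\<ge>N0. N \<ge> 1 \<longrightarrow> sup_norm K (\<lambda>z. f z - Psi N z) \<le> \<epsilon>"
proof -
  obtain r where r: "0 < r" "r < 1" "K \<subseteq> cball 0 r" using compact_in_smaller_disk[OF K] by blast
  obtain N0 where N0: "\<And>N z. N \<ge> N0 \<Longrightarrow> N \<ge> 1 \<Longrightarrow> cmod z \<le> r \<Longrightarrow> cmod (Psi N z) \<le> \<epsilon>"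
    using Psi_uniformly_small[OF r(1,2) \<epsilon>] by blast
  have fz: "f z = 0" if "z \<in> K" for z
    using cmod_le_H_infinity_norm[OF f, of z] that K f0 by auto
  show ?thesis
  proof (intro exI[of _ N0] allI impI sup_norm_leI)
    fix N z assume "N0 \<le> N" "1 \<le> N" "z \<in> K"
    then show "cmod (f z - Psi N z) \<le> \<epsilon>" using N0[of N z] fz r(3) by auto
  qed (use \<epsilon> in auto)
qed

text \<open>The fraction is built from \<open>f\<close>, \<open>\<epsilon>\<close>, \<open>K\<close>
  and \<open>N\<close> alone, before \<open>p\<close>, \<open>\<beta>\<close> and \<open>r\<close>
  are chosen; hence the threshold depends on the first three only.\<close>

lemma simple_fraction_approx:
  fixes C :: real
  assumes C: "\<And>y y'. \<lbrakk>Re y > 0; Re y' > 0; \<bar>Im y\<bar> \<le> 3 * pi / 2; \<bar>Im y'\<bar> \<le> 3 * pi / 2\<rbrakk> \<Longrightarrow>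
      cmod (y / (exp y - 1)) \<le> C \<and> cmod (y / (exp y - 1) - y' / (exp y' - 1)) \<le> C * cmod (y - y')"
    and C0: "C > 0"
    and f: "f \<in> H_infinity" and M: "H_infinity_norm f > 0"
    and \<epsilon>: "\<epsilon> > 0" and K: "compact K" "K \<subseteq> ball 0 1"
  shows "\<exists>N0. \<forall>N\<ge>N0. N \<ge> 1 \<longrightarrow> (\<exists>h\<in>SF N. sup_norm K (\<lambda>z. f z - h z) \<le> \<epsilon> \<and>
    (\<forall>p \<beta> r. p \<ge> 1 \<longrightarrow> \<beta> > 0 \<longrightarrow> 0 < r \<longrightarrow> r < 1 \<longrightarrow>
      circle_mean p h r \<le> (1 + \<beta>) * circle_mean p (Psi N) r
        + rho p \<beta> * ((108 + 48 * C) * H_infinity_norm f) powr p))"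
proof -
  define M where "M = H_infinity_norm f"
  have M0: "M > 0" using assms by (simp add: M_def)
  have fM: "cmod (f z) \<le> M" if "z \<in> ball 0 1" for z
    using cmod_le_H_infinity_norm[OF f that] by (simp add: M_def)
  have hol: "f holomorphic_on ball 0 1" using f by (simp add: H_infinity_def)
  obtain R P where R: "R > 1" "R \<le> 2" and P0: "poly P 0 = 1"
    and P: "\<And>z. cmod z \<le> R \<Longrightarrow> poly P z \<noteq> 0"
    and PM: "\<And>z. cmod z \<le> R \<Longrightarrow> cmod (poly (pderiv P) z / poly P z) \<le> 3 * M"
    and Pf: "\<And>z. z \<in> K \<Longrightarrow> cmod (poly (pderiv P) z / poly P z - f z) \<le> \<epsilon> / 2"
    by (rule logderiv_approx[OF hol fM M0 K half_gt_zero[OF \<epsilon>]]) (assumption, (rule that; assumption))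
  have P1: "poly P z \<noteq> 0" if "cmod z \<le> 1" for z using P[of z] that R by simp
  define E where "E = (108 + 48 * C) * M"
  have E: "E \<ge> 4 * M" using C0 M0 by (simp add: E_def algebra_simps)
  obtain r0 N1 where r0: "1 / 2 \<le> r0" "r0 < 1" and N1: "\<And>N z. N \<ge> N1 \<Longrightarrow> r0 < cmod z \<Longrightarrow> cmod z < 1 \<Longrightarrow>
     (\<exists>\<omega>. poly (self_inversive N P) \<omega> = 0 \<and>
      (cmod (poly (pderiv (self_inversive N P)) z / poly (self_inversive N P) z) \<le> Psi_min N (cmod z) + E \<or>
       Re (z / \<omega>) \<ge> cmod z * cos (pi / real N) \<and>
       cmod (poly (pderiv (self_inversive N P)) z / poly (self_inversive N P) z) \<le> cmod (Psi N (z / \<omega>)) + E))"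
  proof -
    have "\<exists>r0 N0. 1 / 2 \<le> r0 \<and> r0 < 1 \<and> (\<forall>N\<ge>N0. \<forall>z. r0 < cmod z \<longrightarrow> cmod z < 1 \<longrightarrow>
      (\<exists>\<omega>. poly (self_inversive N P) \<omega> = 0 \<and>
       (cmod (poly (pderiv (self_inversive N P)) z / poly (self_inversive N P) z) \<le> Psi_min N (cmod z) + E \<or>
        Re (z / \<omega>) \<ge> cmod z * cos (pi / real N) \<and>
        cmod (poly (pderiv (self_inversive N P)) z / poly (self_inversive N P) z) \<le> cmod (Psi N (z / \<omega>)) + E)))"
      unfolding E_def by (rule logderiv_self_inversive_annulus[where R = R]; fact)
    then show thesis
    proof (elim exE conjE, goal_cases)
      case (1 r0 N1)
      show thesis by (rule that[OF 1(1,2)]) (rule 1(3)[rule_format]; assumption)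
    qed
  qed
  obtain r1 where r1: "0 < r1" "r1 < 1" "K \<subseteq> cball 0 r1" using compact_in_smaller_disk[OF K] by blast
  \<comment> \<open>Up to radius \<open>r2\<close>, closeness to \<open>P' / P\<close> settles both
    claims: it covers \<open>K\<close>, and it gives
    \<open>cmod (h z) \<le> M + 3 * M \<le> E\<close>. Beyond \<open>r2 \<ge> r0\<close> the
    estimate near the circle takes over.\<close>
  define r2 where "r2 = max r0 r1"
  have r2: "0 < r2" "r2 < 1" "r0 \<le> r2" "K \<subseteq> cball 0 r2" using r0 r1 by (auto simp: r2_def)
  have "min M (\<epsilon> / 2) > 0" using M0 \<epsilon> by simp
  obtain N2 where N2: "\<And>N z. N \<ge> N2 \<Longrightarrow> cmod z \<le> r2 \<Longrightarrow>
     cmod (poly (pderiv (self_inversive N P)) z / poly (self_inversive N P) z - poly (pderiv P) z / poly P z) \<le> min M (\<epsilon> / 2)"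
    using logderiv_self_inversive_inside[OF P1 r2(1,2) \<open>min M (\<epsilon> / 2) > 0\<close>] by blast
  show ?thesis
  proof (intro exI[of _ "max (degree P + 1) (max N1 N2)"] allI impI)
    fix N assume N: "max (degree P + 1) (max N1 N2) \<le> N" "1 \<le> N"
    then have Nd: "degree P < N" by simp
    define Q where "Q = self_inversive N P"
    have deg: "degree Q = N" unfolding Q_def using P0 Nd by (intro degree_self_inversive) auto
    have Q0: "Q \<noteq> 0" using deg Nd by auto
    have roots: "cmod z = 1" if "poly Q z = 0" for z
      using self_inversive_root[OF P1 Nd] that by (simp add: Q_def)
    obtain w where w: "\<And>j. j < N \<Longrightarrow> cmod (w j) = 1"
      "\<And>z. poly Q z = 0 \<Longrightarrow> \<exists>j<N. z = w j"
      "\<And>z. poly Q z \<noteq> 0 \<Longrightarrow> (\<Sum>j<N. 1 / (z - w j)) = poly (pderiv Q) z / poly Q z"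
      using simple_fraction_of_unimodular_roots[OF deg Q0 roots] by blast
    define h where "h = (\<lambda>z. \<Sum>j<N. 1 / (z - w j))"
    have hQ: "h z = poly (pderiv Q) z / poly Q z" if "cmod z < 1" for z
      using w(3)[of z] roots[of z] that by (auto simp: h_def)
    have inside: "cmod (h z - poly (pderiv P) z / poly P z) \<le> min M (\<epsilon> / 2)" if "cmod z \<le> r2" for z
      using N2[of N z] N that r2 hQ[of z] by (simp add: Q_def)
    have hSF: "h \<in> SF N" using w(1) unfolding SF_def h_def by auto
    have appr: "sup_norm K (\<lambda>z. f z - h z) \<le> \<epsilon>"
    proof (rule sup_norm_leI)
      fix z assume z: "z \<in> K"
      then have "cmod z \<le> r2" using r2 by auto
      then have "cmod (h z - poly (pderiv P) z / poly P z) \<le> \<epsilon> / 2" using inside[of z] by simp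
      moreover have "cmod (f z - h z) \<le> cmod (poly (pderiv P) z / poly P z - f z) + cmod (h z - poly (pderiv P) z / poly P z)"
        using norm_triangle_ineq4[of "f z - poly (pderiv P) z / poly P z" "h z - poly (pderiv P) z / poly P z"]
        by (simp add: norm_minus_commute)
      ultimately show "cmod (f z - h z) \<le> \<epsilon>" using Pf[OF z] by linarith
    qed (use \<epsilon> in simp)
    have mean: "circle_mean p h r \<le> (1 + \<beta>) * circle_mean p (Psi N) r + rho p \<beta> * E powr p"
      if p: "p \<ge> 1" and \<beta>: "\<beta> > 0" and r: "0 < r" "r < 1" for p \<beta> r
    proof (rule circle_mean_le[OF N(2) p \<beta> r w(1)])
      show "0 \<le> E" using E M0 by simp
      show "continuous_on (ball 0 1) h" unfolding h_def by (rule continuous_on_simple_fraction[OF w(1)])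
      fix z assume z: "cmod z = r"
      show "cmod (h z) \<le> Psi_min N r + E \<or>
        (\<exists>j<N. r * cos (pi / real N) \<le> Re (z / w j) \<and> cmod (h z) \<le> cmod (Psi N (z / w j)) + E)"
      proof (cases "r \<le> r2")
        case True
        then have "cmod (h z - poly (pderiv P) z / poly P z) \<le> M" using inside[of z] z by simp
        moreover have "cmod (poly (pderiv P) z / poly P z) \<le> 3 * M" using PM[of z] z r R by simp
        ultimately have "cmod (h z) \<le> 4 * M"
          using norm_triangle_ineq[of "h z - poly (pderiv P) z / poly P z" "poly (pderiv P) z / poly P z"] by simp
        moreover have "Psi_min N r \<ge> 0" using r by (simp add: Psi_min_def)
        ultimately show ?thesis using E by simp
      next
        case False
        then have "N \<ge> N1" "r0 < cmod z" "cmod z < 1" using N z r r2 by auto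
        from N1[OF this, folded Q_def, folded hQ[OF this(3)], unfolded z] obtain \<omega> where \<omega>: "poly Q \<omega> = 0"
          "cmod (h z) \<le> Psi_min N r + E \<or>
            r * cos (pi / real N) \<le> Re (z / \<omega>) \<and> cmod (h z) \<le> cmod (Psi N (z / \<omega>)) + E"
          by (elim exE conjE)
        obtain j where "j < N" "\<omega> = w j" using w(2)[OF \<omega>(1)] by blast
        then show ?thesis using \<omega>(2) by blast
      qed
    qed
    show "\<exists>h\<in>SF N. sup_norm K (\<lambda>z. f z - h z) \<le> \<epsilon> \<and>
      (\<forall>p \<beta> r. p \<ge> 1 \<longrightarrow> \<beta> > 0 \<longrightarrow> 0 < r \<longrightarrow> r < 1 \<longrightarrow>
        circle_mean p h r \<le> (1 + \<beta>) * circle_mean p (Psi N) r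
          + rho p \<beta> * ((108 + 48 * C) * H_infinity_norm f) powr p)"
      using hSF appr mean[unfolded E_def M_def] by (intro bexI[of _ h] conjI allI impI)
  qed
qed

theorem theorem10:
  "\<exists>C0::real. C0 > 0 \<and>
    (\<forall>f \<in> H_infinity. \<forall>\<epsilon>::real. \<forall>K::complex set.
       \<epsilon> > 0 \<longrightarrow> compact K \<longrightarrow> K \<subseteq> ball 0 1 \<longrightarrow>
       (\<exists>N0::nat. \<forall>N::nat. N \<ge> 1 \<longrightarrow> N \<ge> N0 \<longrightarrow>
          (\<forall>p::real. \<forall>\<beta>::real. p \<ge> 1 \<longrightarrow> \<beta> > 0 \<longrightarrow>
             (\<exists>h \<in> SF N.
                sup_norm K (\<lambda>z. f z - h z) \<le> \<epsilon> \<and>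
                (\<forall>r::real. 0 < r \<longrightarrow> r < 1 \<longrightarrow>
                   circle_mean p h r
                     \<le> (1 + \<beta>) * circle_mean p (Psi N) r
                       + rho p \<beta> * C0 powr p * H_infinity_norm f powr p
                         * ln (exp 1 / (1 - r)) powr p)))))"
proof -
  obtain C :: real where C0: "C > 0" and
    C: "\<And>y y'. \<lbrakk>Re y > 0; Re y' > 0; \<bar>Im y\<bar> \<le> 3 * pi / 2; \<bar>Im y'\<bar> \<le> 3 * pi / 2\<rbrakk> \<Longrightarrow>
      cmod (y / (exp y - 1)) \<le> C \<and> cmod (y / (exp y - 1) - y' / (exp y' - 1)) \<le> C * cmod (y - y')"
    using lipschitz_bernoulli_quotient by blast
  define C1 where "C1 = 108 + 48 * C"
  have C1: "C1 > 0" using C0 by (simp add: C1_def)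
  show ?thesis
  proof (intro exI[of _ C1] conjI ballI allI impI C1)
    fix f \<epsilon> K assume f: "f \<in> H_infinity" and \<epsilon>: "(\<epsilon>::real) > 0" and K: "compact K" "K \<subseteq> ball (0::complex) 1"
    have M0: "H_infinity_norm f \<ge> 0"
      using order.trans[OF norm_ge_zero cmod_le_H_infinity_norm[OF f, of 0]] by simp
    show "\<exists>N0::nat. \<forall>N::nat. N \<ge> 1 \<longrightarrow> N \<ge> N0 \<longrightarrow>
          (\<forall>p::real. \<forall>\<beta>::real. p \<ge> 1 \<longrightarrow> \<beta> > 0 \<longrightarrow>
             (\<exists>h \<in> SF N.
                sup_norm K (\<lambda>z. f z - h z) \<le> \<epsilon> \<and>
                (\<forall>r::real. 0 < r \<longrightarrow> r < 1 \<longrightarrow>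
                   circle_mean p h r
                     \<le> (1 + \<beta>) * circle_mean p (Psi N) r
                       + rho p \<beta> * C1 powr p * H_infinity_norm f powr p
                         * ln (exp 1 / (1 - r)) powr p)))"
    proof (cases "H_infinity_norm f = 0")
      case True
      obtain N0 where N0: "\<And>N. N \<ge> N0 \<Longrightarrow> N \<ge> 1 \<Longrightarrow> sup_norm K (\<lambda>z. f z - Psi N z) \<le> \<epsilon>"
        using Psi_approx_zero[OF f True \<epsilon> K] by blast
      show ?thesis
      proof (intro exI[of _ N0] allI impI)
        fix N :: nat and p \<beta> :: real assume *: "1 \<le> N" "N0 \<le> N" "1 \<le> p" "0 < \<beta>"
        \<comment> \<open>If the integrand were not integrable, the integral would be 0 by default,
          so the sign is settled in either case.\<close>
        have "circle_mean p (Psi N) r \<ge> 0" for r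
          unfolding circle_mean_def
          by (cases "(\<lambda>s. cmod (Psi N (exp (2 * of_real pi * \<i> * of_real s) * of_real r)) powr p) integrable_on {0..1}")
             (auto intro: integral_nonneg simp: not_integrable_integral)
        then have "circle_mean p (Psi N) r \<le> (1 + \<beta>) * circle_mean p (Psi N) r" for r
          using * mult_right_mono[of 1 "1 + \<beta>" "circle_mean p (Psi N) r"] by simp
        then show "\<exists>h \<in> SF N. sup_norm K (\<lambda>z. f z - h z) \<le> \<epsilon> \<and>
                (\<forall>r::real. 0 < r \<longrightarrow> r < 1 \<longrightarrow>
                   circle_mean p h r \<le> (1 + \<beta>) * circle_mean p (Psi N) r
                       + rho p \<beta> * C1 powr p * H_infinity_norm f powr p * ln (exp 1 / (1 - r)) powr p)"
          using * by (intro bexI[of _ "Psi N"] conjI N0 Psi_in_SF) (simp_all add: True)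
      qed
    next
      case False
      then have M: "H_infinity_norm f > 0" using M0 by simp
      obtain N0 where N0: "\<And>N. N \<ge> N0 \<Longrightarrow> N \<ge> 1 \<Longrightarrow> \<exists>h\<in>SF N. sup_norm K (\<lambda>z. f z - h z) \<le> \<epsilon> \<and>
        (\<forall>p \<beta> r. p \<ge> 1 \<longrightarrow> \<beta> > 0 \<longrightarrow> 0 < r \<longrightarrow> r < 1 \<longrightarrow>
          circle_mean p h r \<le> (1 + \<beta>) * circle_mean p (Psi N) r + rho p \<beta> * (C1 * H_infinity_norm f) powr p)"
        using simple_fraction_approx[OF C C0 f M \<epsilon> K, folded C1_def] by blast
      show ?thesis
      proof (intro exI[of _ N0] allI impI)
        fix N :: nat and p \<beta> :: real assume *: "1 \<le> N" "N0 \<le> N" "1 \<le> p" "0 < \<beta>"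
        obtain h where h: "h \<in> SF N" "sup_norm K (\<lambda>z. f z - h z) \<le> \<epsilon>"
          "\<And>r. 0 < r \<Longrightarrow> r < 1 \<Longrightarrow> circle_mean p h r \<le> (1 + \<beta>) * circle_mean p (Psi N) r
              + rho p \<beta> * (C1 * H_infinity_norm f) powr p"
          using N0[OF *(2,1)] *(3,4) by blast
        have "circle_mean p h r \<le> (1 + \<beta>) * circle_mean p (Psi N) r
            + rho p \<beta> * C1 powr p * H_infinity_norm f powr p * ln (exp 1 / (1 - r)) powr p"
          if r: "0 < r" "r < 1" for r
        proof -
          \<comment> \<open>The logarithm is at least 1 for all \<open>r\<close> in question, so the
            bound without it implies the stated one.\<close>
          have "ln (exp 1 / (1 - r)) = 1 - ln (1 - r)" using r by (simp add: ln_div)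
          moreover have "ln (1 - r) \<le> 0" using r by simp
          ultimately have "1 \<le> ln (exp 1 / (1 - r)) powr p" using * by (intro ge_one_powr_ge_zero) auto
          moreover have "rho p \<beta> * (C1 * H_infinity_norm f) powr p \<ge> 0"
            using one_le_rho[of p \<beta>] * by simp
          ultimately have "rho p \<beta> * (C1 * H_infinity_norm f) powr p * 1
              \<le> rho p \<beta> * (C1 * H_infinity_norm f) powr p * ln (exp 1 / (1 - r)) powr p"
            by (intro mult_left_mono) auto
          then show ?thesis using h(3)[OF r] by (simp add: powr_mult mult.assoc)
        qed
        then show "\<exists>h \<in> SF N. sup_norm K (\<lambda>z. f z - h z) \<le> \<epsilon> \<and>
                (\<forall>r::real. 0 < r \<longrightarrow> r < 1 \<longrightarrow>
                   circle_mean p h r \<le> (1 + \<beta>) * circle_mean p (Psi N) r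
                       + rho p \<beta> * C1 powr p * H_infinity_norm f powr p * ln (exp 1 / (1 - r)) powr p)"
          using h by blast
      qed
    qed
  qed
qed

end
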